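(* Let $R\ge R_0=\|x^0-x^*\|$ and let $Q=B_{3R}(x^* )$. Assume that - (bounded variance) $\mathbb{E}\|F_\xi(x)-F(x)\|^2\le\sigma^2$ for all $x\in Q$; - (Lipschitzness) $\|F(x)-F(y)\|\le L\|x-y\|$ for all $x,y\in Q$; - (star-negative comonotonicity) for some $\rho\in[0,\infty)$ and any solution $x^*\in\mathcal X^*$, $\langle F(x),x-x^*\rangle\ge-\rho\|F(x)\|^2$ for all $x\in Q$. Let $$\gamma_2+2\rho\le\gamma_1\le\frac1{160L\ln\frac{6(K+1)}\beta},$$ $$\lambda_{1,k}\equiv\lambda_1=\frac R{20\gamma_1\ln\frac{6(K+1)}\beta},\qquad\lambda_{2,k}\equiv\lambda_2=\frac R{20\gamma_2\ln\frac{6(K+1)}\beta},$$ $$m_{1,k}\equiv m_1\ge\max\left\{1,\frac{216\max\left\{\gamma_1\gamma_2(K+1),\sqrt{\gamma_1^3\gamma_2(K+1)}\,\ln\frac{6(K+1)}\beta\right\}\sigma^2}{R^2}\right\},$$ $$m_{2,k}\equiv m_2\ge\max\left\{1,\frac{3240(K+1)\gamma_2^2\sigma^2\ln\frac{6(K+1)}\beta}{R^2}\right\}$$ for some integer $K\ge0$ and $\beta\in(0,1]$ such that $\ln\frac{6(K+1)}\beta\ge1$. Then, after $K$ iterations, the iterates produced by clipped-SEG satisfy with probability at least $1-\beta$ $$\frac1{K+1}\sum_{k=0}^K\|F(x^k)\|^2\le\frac{36R^2}{\gamma_1\gamma_2(K+1)}.$$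
   Context: Notation: $\|\cdot\|$ is the Euclidean norm, $B_r(x)=\{u\in\mathbb{R}^d:\|u-x\|\le r\}$. $F:\mathbb{R}^d\to\mathbb{R}^d$ with $F(x)=\mathbb{E}_{\xi\sim\mathcal D}[F_\xi(x)]$ for all $x$, where $F_\xi(x)$ is a stochastic oracle. $\mathcal X^*=\{x:F(x)=0\}$ is nonempty, $x^0$ is the starting point, and (except where quantified over all solutions) $x^*$ is the projection of $x^0$ onto $\mathcal X^*$. $\mathrm{clip}(y,\lambda)=\min\{1,\lambda/\|y\|\}y$ for $y\ne0$, $\mathrm{clip}(0,\lambda)=0$, for $\lambda>0$. clipped-SEG, for $k=0,1,\dots$: $\widetilde x^k=x^k-\gamma_1\widetilde F_{\boldsymbol\xi_1^k}(x^k)$, $x^{k+1}=x^k-\gamma_2\widetilde F_{\boldsymbol\xi_2^k}(\widetilde x^k)$, where $\widetilde F_{\boldsymbol\xi_1^k}(x^k)=\mathrm{clip}\left(\frac1{m_{1,k}}\sum_{i=1}^{m_{1,k}}F_{\xi_1^{i,k}}(x^k),\lambda_{1,k}\right)$, $\widetilde F_{\boldsymbol\xi_2^k}(\widetilde x^k)=\mathrm{clip}\left(\frac1{m_{2,k}}\sum_{i=1}^{m_{2,k}}F_{\xi_2^{i,k}}(\widetilde x^k),\lambda_{2,k}\right)$ and all $\xi_1^{i,k},\xi_2^{i,k}$ are independent samples from $\mathcal D$. Stepsizes $\gamma_1,\gamma_2$ and clipping levels are positive (so $R>0$), batchsizes are positive integers. *)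

theory Defs
  imports "HOL-Probability.Probability"
begin

definition solutions :: "('a::euclidean_space \<Rightarrow> 'a) \<Rightarrow> 'a set" where
  "solutions F = {x. F x = 0}"

text \<open>An oracle maps a point \<open>x\<close> and a sample \<open>s\<close> to the estimate of the operator at \<open>x\<close>. Joint
  measurability makes the iterates random variables; \<^const>\<open>has_bochner_integral\<close> includes
  integrability, so that the expectation is not a default value.\<close>

definition stochastic_oracle ::
    "'s measure \<Rightarrow> ('a::euclidean_space \<Rightarrow> 's \<Rightarrow> 'a) \<Rightarrow> ('a \<Rightarrow> 'a) \<Rightarrow> bool" where
  "stochastic_oracle D G F \<longleftrightarrow>
     prob_space D \<and>
     (\<lambda>(x, s). G x s) \<in> borel_measurable (borel \<Otimes>\<^sub>M D) \<and>
     (\<forall>x. has_bochner_integral D (G x) (F x))"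

text \<open>The integral is the nonnegative one, which is infinite (and not zero) when the oracle at \<open>x\<close>
  has no second moment.\<close>

definition bounded_variance_on ::
    "'a set \<Rightarrow> 's measure \<Rightarrow> ('a::euclidean_space \<Rightarrow> 's \<Rightarrow> 'a) \<Rightarrow> ('a \<Rightarrow> 'a) \<Rightarrow> real \<Rightarrow> bool" where
  "bounded_variance_on Q D G F \<sigma> \<longleftrightarrow>
     (\<forall>x\<in>Q. (\<integral>\<^sup>+s. ennreal ((norm (G x s - F x))\<^sup>2) \<partial>D) \<le> ennreal (\<sigma>\<^sup>2))"

definition star_negative_comonotone_on ::
    "'a set \<Rightarrow> ('a::euclidean_space \<Rightarrow> 'a) \<Rightarrow> real \<Rightarrow> bool" where
  "star_negative_comonotone_on Q F \<rho> \<longleftrightarrow>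
     (\<forall>y\<in>solutions F. \<forall>x\<in>Q. F x \<bullet> (x - y) \<ge> - \<rho> * (norm (F x))\<^sup>2)"

definition clip :: "'a::euclidean_space \<Rightarrow> real \<Rightarrow> 'a" where
  "clip y l = (if y = 0 then 0 else min 1 (l / norm y) *\<^sub>R y)"

definition minibatch ::
    "('a::euclidean_space \<Rightarrow> 's \<Rightarrow> 'a) \<Rightarrow> nat \<Rightarrow> (nat \<Rightarrow> 's) \<Rightarrow> 'a \<Rightarrow> 'a" where
  "minibatch G m s x = (1 / real m) *\<^sub>R (\<Sum>i=1..m. G x (s i))"

text \<open>One trajectory of the method: \<open>s1 k i\<close> and \<open>s2 k i\<close> are the realized samples number \<open>i\<close> of
  iteration \<open>k\<close> in the extrapolation step and in the update step.\<close>

primrec clipped_SEG ::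
    "('a::euclidean_space \<Rightarrow> 's \<Rightarrow> 'a) \<Rightarrow> real \<Rightarrow> real \<Rightarrow> (nat \<Rightarrow> real) \<Rightarrow> (nat \<Rightarrow> real) \<Rightarrow>
     (nat \<Rightarrow> nat) \<Rightarrow> (nat \<Rightarrow> nat) \<Rightarrow> 'a \<Rightarrow> (nat \<Rightarrow> nat \<Rightarrow> 's) \<Rightarrow> (nat \<Rightarrow> nat \<Rightarrow> 's) \<Rightarrow> nat \<Rightarrow> 'a" where
  "clipped_SEG G \<gamma>1 \<gamma>2 lam1 lam2 m1 m2 x0 s1 s2 0 = x0"
| "clipped_SEG G \<gamma>1 \<gamma>2 lam1 lam2 m1 m2 x0 s1 s2 (Suc k) =
     (let x = clipped_SEG G \<gamma>1 \<gamma>2 lam1 lam2 m1 m2 x0 s1 s2 k;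
          x' = x - \<gamma>1 *\<^sub>R clip (minibatch G (m1 k) (s1 k) x) (lam1 k)
      in x - \<gamma>2 *\<^sub>R clip (minibatch G (m2 k) (s2 k) x') (lam2 k))"

text \<open>All samples of both steps and of all iterations form one independent family, hence the index
  set is a disjoint sum.\<close>

definition independent_samples ::
    "'w measure \<Rightarrow> 's measure \<Rightarrow> (nat \<Rightarrow> nat) \<Rightarrow> (nat \<Rightarrow> nat) \<Rightarrow>
     (nat \<Rightarrow> nat \<Rightarrow> 'w \<Rightarrow> 's) \<Rightarrow> (nat \<Rightarrow> nat \<Rightarrow> 'w \<Rightarrow> 's) \<Rightarrow> bool" where
  "independent_samples M D m1 m2 \<xi>1 \<xi>2 \<longleftrightarrow>
     prob_space.indep_vars M (\<lambda>_. D) (case_sum (\<lambda>(k, i). \<xi>1 k i) (\<lambda>(k, i). \<xi>2 k i))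
       ((SIGMA k:UNIV. {1..m1 k}) <+> (SIGMA k:UNIV. {1..m2 k})) \<and>
     (\<forall>k. \<forall>i\<in>{1..m1 k}. distr M D (\<xi>1 k i) = D) \<and>
     (\<forall>k. \<forall>i\<in>{1..m2 k}. distr M D (\<xi>2 k i) = D)"

end

theory Submission
  imports Defs
begin

text \<open>Deterministically, each iteration decreases \<open>\<parallel>x - x\<^sup>*\<parallel>\<^sup>2\<close> by \<open>\<gamma>\<^sub>1 \<gamma>\<^sub>2 \<parallel>F x\<parallel>\<^sup>2 / 4\<close>
  up to a noise term. Clipping is the projection onto a ball that contains the mean, hence it does
  not increase the variance, and its bias is at most variance over twice the clipping level.
  Noise is counted only in iterations that start in the ball of radius \<open>2R\<close>. With \<open>A\<close> the logarithm of
  the theorem, the exponential moment at rate \<open>A / R\<^sup>2\<close> of the counted noise grows by a factor at most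
  \<open>exp (A / (K + 1))\<close> per iteration, so by Markov's inequality each partial sum exceeds \<open>3R\<^sup>2\<close> with
  probability at most \<open>exp (- 2 A)\<close>. If no partial sum does, no iterate leaves the ball, all
  noise is counted, and the sum of the \<open>\<parallel>F x\<parallel>\<^sup>2\<close> is at most \<open>16 R\<^sup>2 / (\<gamma>\<^sub>1 \<gamma>\<^sub>2)\<close>.\<close>

section \<open>Clipping as projection onto a ball, and an elementary bound on the
  exponential\<close>

lemma norm_clip_le:
  assumes "0 < l"
  shows "norm (clip y l) \<le> l"
proof (cases "y = 0")
  case False
  then have "norm (clip y l) = min 1 (l / norm y) * norm y"
    using assms by (simp add: clip_def)
  also have "\<dots> \<le> l / norm y * norm y"
    by (intro mult_right_mono) auto
  finally show ?thesis
    using False by simp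
qed (use assms in \<open>simp add: clip_def\<close>)

lemma clip_eq_self:
  assumes "norm y \<le> l"
  shows "clip y l = y"
  using assms by (auto simp: clip_def min_def field_simps)

lemma clip_eq_scaled:
  assumes "0 < l" "l < norm y"
  shows "clip y l = (l / norm y) *\<^sub>R y"
  using assms by (auto simp: clip_def min_def field_simps)

lemma borel_measurable_clip [measurable]: "(\<lambda>y. clip y l) \<in> borel_measurable borel"
  unfolding clip_def by measurable

text \<open>Projection onto a convex set does not increase the distance to a point \<open>z\<close>
  of that set. Integrated with \<open>z\<close> the mean, this shows that clipping does not increase
  the variance around the mean.\<close>

lemma norm_clip_diff_le:
  fixes y z :: "'a::euclidean_space"
  assumes "0 < l" "norm z \<le> l"
  shows "norm (clip y l - z) \<le> norm (y - z)"
proof (cases "norm y \<le> l")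
  case False
  define p where "p = clip y l"
  define t where "t = norm y / l - 1"
  have p: "p = (l / norm y) *\<^sub>R y" and np: "norm p = l" and t: "t \<ge> 0"
    using False assms clip_eq_scaled[of l y] by (auto simp: p_def t_def field_simps)
  \<comment> \<open>\<open>p\<close> lies on the segment from 0 to \<open>y\<close>, so the residual
    is a nonnegative multiple of \<open>p\<close>. The cross term then has the sign of
    \<open>(norm p)\<^sup>2 - p \<bullet> z\<close>, which Cauchy-Schwarz settles since
    \<open>norm z \<le> l = norm p\<close>.\<close>
  have "y - p = t *\<^sub>R p"
    using False assms by (simp add: p t_def algebra_simps)
  then have "(norm (y - z))\<^sup>2 = (norm (t *\<^sub>R p + (p - z)))\<^sup>2"
    by (metis diff_add_cancel add_diff_eq)
  also have "\<dots> = t\<^sup>2 * (norm p)\<^sup>2 + 2 * t * ((norm p)\<^sup>2 - p \<bullet> z) + (norm (p - z))\<^sup>2"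
    unfolding power2_norm_eq_inner
    by (simp add: inner_add inner_diff inner_commute[of z p] power2_eq_square algebra_simps)
  also have "\<dots> \<ge> (norm (p - z))\<^sup>2"
  proof -
    have "p \<bullet> z \<le> norm p * norm z"
      by (rule norm_cauchy_schwarz)
    also have "\<dots> \<le> (norm p)\<^sup>2"
      using assms by (simp add: np power2_eq_square)
    finally show ?thesis
      using t by simp
  qed
  finally show ?thesis
    by (simp add: p_def)
qed (simp add: clip_eq_self)

text \<open>Outside the ball the error is \<open>norm y - l\<close>, hence at most
  \<open>norm (y - z) - l / 2\<close> because \<open>z\<close> stays within half the level. A bound
  quadratic in \<open>norm (y - z)\<close> is wanted because its expectation is a variance.\<close>

lemma norm_clip_bias_le:
  fixes y z :: "'a::euclidean_space"
  assumes "0 < l" "norm z \<le> l / 2"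
  shows "norm (clip y l - y) \<le> (norm (y - z))\<^sup>2 / (2 * l)"
proof (cases "norm y \<le> l")
  case True
  then show ?thesis
    using assms by (simp add: clip_eq_self)
next
  case False
  then have "clip y l - y = - ((1 - l / norm y) *\<^sub>R y)"
    using assms by (simp add: clip_eq_scaled algebra_simps)
  then have "norm (clip y l - y) = \<bar>1 - l / norm y\<bar> * norm y"
    by (metis norm_minus_cancel norm_scaleR)
  also have "\<dots> = norm y - l"
    using False assms by (auto simp: abs_if field_simps)
  also have "\<dots> \<le> norm (y - z) - l / 2"
    using norm_triangle_sub[of y z] assms by linarith
  also have "\<dots> \<le> (norm (y - z))\<^sup>2 / (2 * l)"
  proof -
    \<comment> \<open>With \<open>d = norm (y - z)\<close>, this rearranges to
      \<open>d - l / 2 \<le> d\<^sup>2 / (2 * l)\<close>.\<close>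
    have "0 \<le> (norm (y - z) - l)\<^sup>2"
      by simp
    then show ?thesis
      using assms by (simp add: field_simps power2_eq_square)
  qed
  finally show ?thesis .
qed

text \<open>For negative \<open>y = - z\<close> the claim is
  \<open>1 \<le> (1 - z + z\<^sup>2) * exp z\<close>. It follows by replacing \<open>exp z\<close>
  with its second Taylor polynomial, since the product then has only nonnegative terms besides
  1.\<close>

lemma exp_le_quadratic:
  fixes y :: real
  assumes "y \<le> 1"
  shows "exp y \<le> 1 + y + y\<^sup>2"
proof (cases "0 \<le> y")
  case True
  then show ?thesis
    using assms by (rule exp_bound)
next
  case False
  define z where "z = - y"
  have z: "z \<ge> 0"
    using False by (simp add: z_def)
  have q: "1 + z + z\<^sup>2 / 2 \<le> exp z"
    using z by (rule exp_lower_Taylor_quadratic)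
  have "1 - z + z\<^sup>2 = (z - 1/2)\<^sup>2 + 3/4"
    by (simp add: power2_eq_square algebra_simps)
  then have nonneg: "0 \<le> 1 - z + z\<^sup>2"
    by simp
  have "1 \<le> 1 + z\<^sup>2 / 2 + z ^ 3 / 2 + z ^ 4 / 2"
    using z by simp
  also have "\<dots> = (1 - z + z\<^sup>2) * (1 + z + z\<^sup>2 / 2)"
    by (simp add: field_simps power2_eq_square power3_eq_cube power4_eq_xxxx)
  also have "\<dots> \<le> (1 - z + z\<^sup>2) * exp z"
    using q nonneg by (rule mult_left_mono)
  finally have "exp (- z) \<le> 1 - z + z\<^sup>2"
    by (simp add: exp_minus field_simps)
  then show ?thesis
    by (simp add: z_def)
qed

section \<open>Deterministic progress of one iteration\<close>

text \<open>In the application \<open>g = F x\<close>, \<open>w\<close> is its clipped estimate,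
  \<open>h\<close> is \<open>F\<close> at the extrapolated point \<open>x - a *\<^sub>R w\<close>,
  \<open>u\<close> is the clipped estimate of \<open>h\<close>, and \<open>p\<close> is a solution.
  Comonotonicity trades \<open>h \<bullet> (x - p)\<close> for \<open>w \<bullet> h\<close>, and
  polarization with the Lipschitz bound extracts \<open>- (norm g)\<^sup>2 / 4\<close> from it. The
  vector paired with \<open>h - u\<close> does not involve \<open>u\<close>, so once
  \<open>x\<close> and \<open>h\<close> are fixed, the mean of that term sees only the bias of
  \<open>u\<close>.\<close>

lemma extragradient_step:
  fixes x w u g h p :: "'a::real_inner"
  assumes "0 \<le> b" "0 \<le> a" "b + 2 * \<rho> \<le> a"
    and comonotone: "h \<bullet> (x - a *\<^sub>R w - p) \<ge> - \<rho> * (norm h)\<^sup>2"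
    and lipschitz: "norm (g - h) \<le> norm w / 2"
  shows "(norm (x - b *\<^sub>R u - p))\<^sup>2 + a * b / 4 * (norm g)\<^sup>2
    \<le> (norm (x - p))\<^sup>2
      + (2 * b * ((x - p - b *\<^sub>R h) \<bullet> (h - u)) + b\<^sup>2 * (norm (h - u))\<^sup>2)
      + 3 * (a * b) * (norm (g - w))\<^sup>2"
proof -
  have two: "(norm (y + z))\<^sup>2 \<le> 2 * (norm y)\<^sup>2 + 2 * (norm z)\<^sup>2" for y z :: 'a
  proof -
    have "0 \<le> (norm (y - z))\<^sup>2"
      by simp
    then show ?thesis
      unfolding power2_norm_eq_inner by (simp add: inner_add inner_diff inner_commute[of z y])
  qed
  have "(norm (g - h))\<^sup>2 \<le> (norm w / 2)\<^sup>2"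
    using lipschitz by (intro power_mono) auto
  then have "(norm (w - h))\<^sup>2 \<le> (norm w)\<^sup>2 / 2 + 2 * (norm (g - w))\<^sup>2"
    using two[of "g - h" "w - g"] by (simp add: norm_minus_commute power_divide)
  moreover have "(norm g)\<^sup>2 \<le> 2 * (norm w)\<^sup>2 + 2 * (norm (g - w))\<^sup>2"
    using two[of w "g - w"] by simp
  moreover have "(norm (w - h))\<^sup>2 = (norm w)\<^sup>2 - 2 * (w \<bullet> h) + (norm h)\<^sup>2"
    unfolding power2_norm_eq_inner by (simp add: inner_diff inner_commute[of h w])
  \<comment> \<open>The coefficient of \<open>(norm (g - w))\<^sup>2\<close> obtained is 2 + 1/2,
    rounded up to 3.\<close>
  ultimately have cross: "- 2 * (w \<bullet> h) \<le> 3 * (norm (g - w))\<^sup>2 - (norm g)\<^sup>2 / 4 - (norm h)\<^sup>2"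
    using zero_le_power2[of "norm (g - w)"] by linarith
  have "- 2 * (h \<bullet> (x - p)) \<le> 2 * \<rho> * (norm h)\<^sup>2 + a * (- 2 * (w \<bullet> h))"
    using comonotone by (simp add: inner_diff inner_commute[of w h] algebra_simps)
  also have "\<dots> \<le> 2 * \<rho> * (norm h)\<^sup>2 + a * (3 * (norm (g - w))\<^sup>2 - (norm g)\<^sup>2 / 4 - (norm h)\<^sup>2)"
    using cross \<open>0 \<le> a\<close> by (intro add_left_mono mult_left_mono)
  finally have "b * (- 2 * (h \<bullet> (x - p)))
      \<le> b * (2 * \<rho> * (norm h)\<^sup>2 + a * (3 * (norm (g - w))\<^sup>2 - (norm g)\<^sup>2 / 4 - (norm h)\<^sup>2))"
    using \<open>0 \<le> b\<close> by (rule mult_left_mono)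
  \<comment> \<open>The stepsize condition enters here: the \<open>- a * b\<close> multiple of
    \<open>(norm h)\<^sup>2\<close> pays for the \<open>b\<^sup>2\<close> of the expanded square and
    for the \<open>2 * \<rho> * b\<close> of comonotonicity.\<close>
  moreover have "b * (norm h)\<^sup>2 * (b + 2 * \<rho> - a) \<le> 0"
    using assms by (intro mult_nonneg_nonpos) auto
  moreover have "(norm (x - b *\<^sub>R u - p))\<^sup>2
      = (norm (x - p))\<^sup>2 + b * (- 2 * (h \<bullet> (x - p))) + b\<^sup>2 * (norm h)\<^sup>2
      + (2 * b * ((x - p - b *\<^sub>R h) \<bullet> (h - u)) + b\<^sup>2 * (norm (h - u))\<^sup>2)"
    unfolding power2_norm_eq_inner
    by (simp add: inner_add inner_diff inner_commute power2_eq_square algebra_simps)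
  ultimately show ?thesis
    by (simp add: algebra_simps power2_eq_square)
qed

section \<open>Means and second moments of minibatches\<close>

context prob_space
begin

lemma sum_indep_second_moment:
  fixes X :: "'i \<Rightarrow> 'a \<Rightarrow> 'b::euclidean_space"
  assumes I: "finite I" and indep: "indep_vars (\<lambda>_. borel) X I"
    and int: "\<And>i. i \<in> I \<Longrightarrow> integrable M (X i)"
    and mean: "\<And>i. i \<in> I \<Longrightarrow> expectation (X i) = 0"
    and sq: "\<And>i. i \<in> I \<Longrightarrow> (\<integral>\<^sup>+\<omega>. ennreal ((norm (X i \<omega>))\<^sup>2) \<partial>M) \<le> ennreal v"
    and v: "0 \<le> v"
  shows "integrable M (\<lambda>\<omega>. (norm (\<Sum>i\<in>I. X i \<omega>))\<^sup>2)"
    and "expectation (\<lambda>\<omega>. (norm (\<Sum>i\<in>I. X i \<omega>))\<^sup>2) \<le> real (card I) * v"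
proof -
  have meas: "X i \<in> borel_measurable M" if "i \<in> I" for i
    using int[OF that] by simp
  have diag: "integrable M (\<lambda>\<omega>. X i \<omega> \<bullet> X i \<omega>)" "expectation (\<lambda>\<omega>. X i \<omega> \<bullet> X i \<omega>) \<le> v"
    if "i \<in> I" for i
  proof -
    note [measurable] = meas[OF that]
    \<comment> \<open>The nonnegative integral certifies integrability, which a bound on a Bochner
      integral with its default value 0 could not do.\<close>
    have "(\<integral>\<^sup>+\<omega>. ennreal (norm ((norm (X i \<omega>))\<^sup>2)) \<partial>M) < \<infinity>"
      using sq[OF that] by (simp add: le_less_trans)
    then have int2: "integrable M (\<lambda>\<omega>. (norm (X i \<omega>))\<^sup>2)"
      by (intro integrableI_bounded) auto
    then show "integrable M (\<lambda>\<omega>. X i \<omega> \<bullet> X i \<omega>)"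
      by (simp add: power2_norm_eq_inner)
    have "ennreal (expectation (\<lambda>\<omega>. (norm (X i \<omega>))\<^sup>2)) \<le> ennreal v"
      using sq[OF that] int2 by (subst nn_integral_eq_integral[symmetric]) auto
    then show "expectation (\<lambda>\<omega>. X i \<omega> \<bullet> X i \<omega>) \<le> v"
      using v by (simp add: power2_norm_eq_inner)
  qed
  have off: "has_bochner_integral M (\<lambda>\<omega>. X i \<omega> \<bullet> X j \<omega>) 0" if "i \<in> I" "j \<in> I" "i \<noteq> j" for i j
  proof -
    \<comment> \<open>The inner product of two independent vectors is expanded over
      \<open>Basis\<close>, so that the product rule for expectations is applied to real
      coordinates.\<close>
    have prod: "has_bochner_integral M (\<lambda>\<omega>. (X i \<omega> \<bullet> b) * (X j \<omega> \<bullet> b)) 0" for b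
    proof -
      have "indep_vars (\<lambda>_. borel) (\<lambda>k \<omega>. X k \<omega> \<bullet> b) I"
        using indep by (rule indep_vars_compose2) simp
      then have "indep_vars (\<lambda>_. borel) (\<lambda>k \<omega>. X k \<omega> \<bullet> b) (insert i {j})"
        using that by (auto intro: indep_vars_subset)
      \<comment> \<open>Independence of one variable from a finite sum of others is taken with the
        singleton sum over \<open>{j}\<close>.\<close>
      then have ind: "indep_var borel (\<lambda>\<omega>. X i \<omega> \<bullet> b) borel (\<lambda>\<omega>. X j \<omega> \<bullet> b)"
        using indep_vars_sum[of "{j}" i "\<lambda>k \<omega>. X k \<omega> \<bullet> b"] that by simp
      have int': "integrable M (\<lambda>\<omega>. X i \<omega> \<bullet> b)" "integrable M (\<lambda>\<omega>. X j \<omega> \<bullet> b)"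
        using int that by auto
      have "expectation (\<lambda>\<omega>. X i \<omega> \<bullet> b) = 0"
        using int mean that by simp
      then show ?thesis
        using indep_var_integrable[OF ind int'] indep_var_lebesgue_integral[OF ind int']
        by (simp add: has_bochner_integral_iff)
    qed
    have "has_bochner_integral M (\<lambda>\<omega>. \<Sum>b\<in>Basis. (X i \<omega> \<bullet> b) * (X j \<omega> \<bullet> b)) (\<Sum>b\<in>(Basis::'b set). 0)"
      by (intro has_bochner_integral_sum prod)
    then show ?thesis
      by (simp add: euclidean_inner[symmetric])
  qed
  have expand: "(norm (\<Sum>i\<in>I. X i \<omega>))\<^sup>2 = (\<Sum>i\<in>I. \<Sum>j\<in>I. X i \<omega> \<bullet> X j \<omega>)" for \<omega>
    unfolding power2_norm_eq_inner inner_sum_left[of _ I] by (simp add: inner_sum_right)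
  have int_all: "integrable M (\<lambda>\<omega>. X i \<omega> \<bullet> X j \<omega>)" if "i \<in> I" "j \<in> I" for i j
    using diag off that by (cases "i = j") (auto simp: has_bochner_integral_iff)
  then show "integrable M (\<lambda>\<omega>. (norm (\<Sum>i\<in>I. X i \<omega>))\<^sup>2)"
    unfolding expand by (intro Bochner_Integration.integrable_sum)
  have "expectation (\<lambda>\<omega>. (norm (\<Sum>i\<in>I. X i \<omega>))\<^sup>2)
      = (\<Sum>i\<in>I. \<Sum>j\<in>I. expectation (\<lambda>\<omega>. X i \<omega> \<bullet> X j \<omega>))"
    unfolding expand using int_all
    by (subst Bochner_Integration.integral_sum; (intro Bochner_Integration.integrable_sum)?) (auto intro!: sum.cong)
  also have "\<dots> = (\<Sum>i\<in>I. \<Sum>j\<in>I. if i = j then expectation (\<lambda>\<omega>. X i \<omega> \<bullet> X j \<omega>) else 0)"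
    using off by (intro sum.cong) (auto simp: has_bochner_integral_iff)
  also have "\<dots> = (\<Sum>i\<in>I. expectation (\<lambda>\<omega>. X i \<omega> \<bullet> X i \<omega>))"
    using I by simp
  also have "\<dots> \<le> real (card I) * v"
    using diag(2) by (rule sum_bounded_above)
  finally show "expectation (\<lambda>\<omega>. (norm (\<Sum>i\<in>I. X i \<omega>))\<^sup>2) \<le> real (card I) * v" .
qed

text \<open>The map \<open>\<iota>\<close> picks one batch out of a larger independent family, so
  extrapolation and update batches of any iteration are both covered. Centered independent terms
  have no cross moments, and the square of the factor \<open>1 / real m\<close> leaves
  \<open>v / real m\<close>. The point \<open>x\<close> is deterministic.\<close>

lemma minibatch_moments:
  fixes G :: "'b::euclidean_space \<Rightarrow> 's \<Rightarrow> 'b"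
  assumes G: "stochastic_oracle D G F"
    and inj: "inj_on \<iota> {1..m}" and indep: "indep_vars (\<lambda>_. D) \<xi> (\<iota> ` {1..m})"
    and distr: "\<And>j. j \<in> \<iota> ` {1..m} \<Longrightarrow> distr M D (\<xi> j) = D"
    and m: "0 < m"
    and var: "(\<integral>\<^sup>+s. ennreal ((norm (G x s - F x))\<^sup>2) \<partial>D) \<le> ennreal v" and v: "0 \<le> v"
  shows "integrable M (\<lambda>\<omega>. minibatch G m (\<lambda>i. \<xi> (\<iota> i) \<omega>) x)"
    and "expectation (\<lambda>\<omega>. minibatch G m (\<lambda>i. \<xi> (\<iota> i) \<omega>) x) = F x"
    and "integrable M (\<lambda>\<omega>. (norm (minibatch G m (\<lambda>i. \<xi> (\<iota> i) \<omega>) x - F x))\<^sup>2)"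
    and "expectation (\<lambda>\<omega>. (norm (minibatch G m (\<lambda>i. \<xi> (\<iota> i) \<omega>) x - F x))\<^sup>2) \<le> v / real m"
proof -
  have D: "prob_space D" and [measurable]: "(\<lambda>(x, s). G x s) \<in> borel_measurable (borel \<Otimes>\<^sub>M D)"
    and hb: "has_bochner_integral D (G x) (F x)"
    using G by (auto simp: stochastic_oracle_def)
  have [measurable]: "G x \<in> borel_measurable D"
    by measurable
  have rv[measurable]: "\<xi> j \<in> measurable M D" if "j \<in> \<iota> ` {1..m}" for j
    using indep that by (auto simp: indep_vars_def)
  have hb_i: "has_bochner_integral M (\<lambda>\<omega>. G x (\<xi> j \<omega>)) (F x)" if "j \<in> \<iota> ` {1..m}" for j
    using hb distr[OF that] rv[OF that]
      integrable_distr_eq[of "\<xi> j" M D "G x"] integral_distr[of "\<xi> j" M D "G x"]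
    by (simp add: has_bochner_integral_iff)
  have "has_bochner_integral M (\<lambda>\<omega>. \<Sum>i=1..m. G x (\<xi> (\<iota> i) \<omega>)) (\<Sum>i=1..m. F x)"
    by (intro has_bochner_integral_sum hb_i) simp
  then have "has_bochner_integral M (\<lambda>\<omega>. minibatch G m (\<lambda>i. \<xi> (\<iota> i) \<omega>) x) ((1 / real m) *\<^sub>R (\<Sum>i=1..m. F x))"
    unfolding minibatch_def by (rule has_bochner_integral_scaleR_right)
  then have "has_bochner_integral M (\<lambda>\<omega>. minibatch G m (\<lambda>i. \<xi> (\<iota> i) \<omega>) x) (F x)"
    using m by (simp add: sum_constant_scaleR)
  then show "integrable M (\<lambda>\<omega>. minibatch G m (\<lambda>i. \<xi> (\<iota> i) \<omega>) x)"
    and "expectation (\<lambda>\<omega>. minibatch G m (\<lambda>i. \<xi> (\<iota> i) \<omega>) x) = F x"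
    by (auto simp: has_bochner_integral_iff)
  define X where "X j \<omega> = G x (\<xi> j \<omega>) - F x" for j \<omega>
  have ind: "indep_vars (\<lambda>_. borel) X (\<iota> ` {1..m})"
    unfolding X_def by (rule indep_vars_compose2[OF indep]) measurable
  have int: "integrable M (X j)" and mean: "expectation (X j) = 0" if "j \<in> \<iota> ` {1..m}" for j
    unfolding X_def using hb_i[OF that] by (auto simp: has_bochner_integral_iff prob_space)
  have sq: "(\<integral>\<^sup>+\<omega>. ennreal ((norm (X j \<omega>))\<^sup>2) \<partial>M) \<le> ennreal v" if "j \<in> \<iota> ` {1..m}" for j
  proof -
    have "(\<integral>\<^sup>+\<omega>. ennreal ((norm (X j \<omega>))\<^sup>2) \<partial>M)
        = (\<integral>\<^sup>+s. ennreal ((norm (G x s - F x))\<^sup>2) \<partial>distr M D (\<xi> j))"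
      using rv[OF that] by (subst nn_integral_distr) (auto simp: X_def)
    then show ?thesis
      using var distr[OF that] by simp
  qed
  have eq: "minibatch G m (\<lambda>i. \<xi> (\<iota> i) \<omega>) x - F x = (1 / real m) *\<^sub>R (\<Sum>j\<in>\<iota> ` {1..m}. X j \<omega>)" for \<omega>
    using m inj by (simp add: minibatch_def X_def sum.reindex card_image sum_subtractf sum_constant_scaleR algebra_simps)
  have eq2: "(norm (minibatch G m (\<lambda>i. \<xi> (\<iota> i) \<omega>) x - F x))\<^sup>2
      = (1 / real m)\<^sup>2 * (norm (\<Sum>j\<in>\<iota> ` {1..m}. X j \<omega>))\<^sup>2" for \<omega>
    unfolding eq by (simp add: power_divide)
  have mom: "integrable M (\<lambda>\<omega>. (norm (\<Sum>j\<in>\<iota> ` {1..m}. X j \<omega>))\<^sup>2)"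
    "expectation (\<lambda>\<omega>. (norm (\<Sum>j\<in>\<iota> ` {1..m}. X j \<omega>))\<^sup>2) \<le> real m * v"
    using sum_indep_second_moment[OF finite_imageI[OF finite_atLeastAtMost] ind int mean sq v] inj
    by (simp_all add: card_image)
  show "integrable M (\<lambda>\<omega>. (norm (minibatch G m (\<lambda>i. \<xi> (\<iota> i) \<omega>) x - F x))\<^sup>2)"
    unfolding eq2 using mom(1) by (rule integrable_mult_right)
  have "expectation (\<lambda>\<omega>. (norm (minibatch G m (\<lambda>i. \<xi> (\<iota> i) \<omega>) x - F x))\<^sup>2)
      = (1 / real m)\<^sup>2 * expectation (\<lambda>\<omega>. (norm (\<Sum>j\<in>\<iota> ` {1..m}. X j \<omega>))\<^sup>2)"
    unfolding eq2 by (rule integral_mult_right_zero)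
  also have "\<dots> \<le> (1 / real m)\<^sup>2 * (real m * v)"
    using mom(2) by (rule mult_left_mono) simp
  also have "\<dots> = v / real m"
    using m by (simp add: power2_eq_square)
  finally show "expectation (\<lambda>\<omega>. (norm (minibatch G m (\<lambda>i. \<xi> (\<iota> i) \<omega>) x - F x))\<^sup>2) \<le> v / real m" .
qed

section \<open>Exponential moments of clipping errors\<close>

text \<open>The quadratic bound on \<open>exp\<close> reduces the exponential moment to the first
  two moments, and \<open>1 + d \<le> exp d\<close> restores a form that multiplies over
  iterations.\<close>

lemma exp_moment_le:
  fixes Z :: "'a \<Rightarrow> real"
  assumes [measurable]: "Z \<in> borel_measurable M"
    and bound: "\<And>\<omega>. \<bar>Z \<omega>\<bar> \<le> 1"
    and moments: "expectation Z + expectation (\<lambda>\<omega>. (Z \<omega>)\<^sup>2) \<le> d"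
  shows "(\<integral>\<^sup>+\<omega>. ennreal (exp (Z \<omega>)) \<partial>M) \<le> ennreal (exp d)"
proof -
  have int: "integrable M Z" "integrable M (\<lambda>\<omega>. (Z \<omega>)\<^sup>2)"
    using bound by (auto intro!: integrable_const_bound[where B = 1] simp: abs_square_le_1)
  have "(\<integral>\<^sup>+\<omega>. ennreal (exp (Z \<omega>)) \<partial>M) \<le> (\<integral>\<^sup>+\<omega>. ennreal (1 + Z \<omega> + (Z \<omega>)\<^sup>2) \<partial>M)"
    using bound by (intro nn_integral_mono ennreal_leI exp_le_quadratic) (simp add: abs_le_iff)
  also have "\<dots> = ennreal (expectation (\<lambda>\<omega>. 1 + Z \<omega> + (Z \<omega>)\<^sup>2))"
  proof (rule nn_integral_eq_integral)
    \<comment> \<open>Nonnegativity matters because \<open>ennreal\<close> truncates negative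
      values; it holds since \<open>1 + Z \<omega> \<ge> 0\<close>.\<close>
    show "AE \<omega> in M. 0 \<le> 1 + Z \<omega> + (Z \<omega>)\<^sup>2"
    proof (rule AE_I2)
      fix \<omega>
      show "0 \<le> 1 + Z \<omega> + (Z \<omega>)\<^sup>2"
        using bound[of \<omega>] zero_le_power2[of "Z \<omega>"] by linarith
    qed
  qed (use int in simp)
  also have "expectation (\<lambda>\<omega>. 1 + Z \<omega> + (Z \<omega>)\<^sup>2)
      = 1 + (expectation Z + expectation (\<lambda>\<omega>. (Z \<omega>)\<^sup>2))"
    using int by (simp add: prob_space)
  also have "\<dots> \<le> exp d"
    using moments exp_ge_add_one_self[of d] by linarith
  finally show ?thesis
    by (simp add: ennreal_leI)
qed

context
  fixes X :: "'a \<Rightarrow> 'b::euclidean_space" and z :: 'b and v l :: real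
  assumes int: "integrable M X" and mean: "expectation X = z"
    and int_sq: "integrable M (\<lambda>\<omega>. (norm (X \<omega> - z))\<^sup>2)"
    and var: "expectation (\<lambda>\<omega>. (norm (X \<omega> - z))\<^sup>2) \<le> v"
    and l: "0 < l" and z: "norm z \<le> l / 2"
begin

lemma clipped_noise_measurable [measurable]: "(\<lambda>\<omega>. z - clip (X \<omega>) l) \<in> borel_measurable M"
  using int by measurable

lemma norm_clipped_noise_le: "norm (z - clip (X \<omega>) l) \<le> 3 / 2 * l"
  using norm_triangle_ineq4[of z "clip (X \<omega>) l"] norm_clip_le[OF l, of "X \<omega>"] z by linarith

lemma integrable_clipped_noise:
  "integrable M (\<lambda>\<omega>. z - clip (X \<omega>) l)" "integrable M (\<lambda>\<omega>. (norm (z - clip (X \<omega>) l))\<^sup>2)"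
proof -
  show "integrable M (\<lambda>\<omega>. z - clip (X \<omega>) l)"
    using norm_clipped_noise_le by (intro integrable_const_bound[where B = "3 / 2 * l"]) auto
  have "(norm (z - clip (X \<omega>) l))\<^sup>2 \<le> (3 / 2 * l)\<^sup>2" for \<omega>
    using norm_clipped_noise_le by (intro power_mono) auto
  then show "integrable M (\<lambda>\<omega>. (norm (z - clip (X \<omega>) l))\<^sup>2)"
    by (intro integrable_const_bound[where B = "(3 / 2 * l)\<^sup>2"]) auto
qed

lemma clipped_noise_second_moment: "expectation (\<lambda>\<omega>. (norm (z - clip (X \<omega>) l))\<^sup>2) \<le> v"
proof -
  have "(norm (z - clip (X \<omega>) l))\<^sup>2 \<le> (norm (X \<omega> - z))\<^sup>2" for \<omega>
    using norm_clip_diff_le[OF l, of z "X \<omega>"] z l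
    by (intro power_mono) (auto simp: norm_minus_commute)
  then have "expectation (\<lambda>\<omega>. (norm (z - clip (X \<omega>) l))\<^sup>2) \<le> expectation (\<lambda>\<omega>. (norm (X \<omega> - z))\<^sup>2)"
    by (intro integral_mono integrable_clipped_noise int_sq)
  then show ?thesis
    using var by linarith
qed

text \<open>\<open>X\<close> is unbiased, so \<open>z\<close> may be replaced by \<open>X\<close>
  inside the expectation; the pointwise quadratic bound on the clipping error then integrates to the
  variance.\<close>

lemma clipped_noise_bias: "norm (expectation (\<lambda>\<omega>. z - clip (X \<omega>) l)) \<le> v / (2 * l)"
proof -
  have int_clip: "integrable M (\<lambda>\<omega>. clip (X \<omega>) l)"
    using int norm_clip_le[OF l] by (auto intro!: integrable_const_bound[where B = l])
  have "expectation (\<lambda>\<omega>. z - clip (X \<omega>) l) = expectation (\<lambda>\<omega>. X \<omega> - clip (X \<omega>) l)"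
    using int int_clip mean by (simp add: prob_space)
  also have "norm \<dots> \<le> expectation (\<lambda>\<omega>. norm (X \<omega> - clip (X \<omega>) l))"
    by (rule integral_norm_bound)
  also have "\<dots> \<le> expectation (\<lambda>\<omega>. (norm (X \<omega> - z))\<^sup>2 / (2 * l))"
  proof (rule integral_mono)
    show "norm (X \<omega> - clip (X \<omega>) l) \<le> (norm (X \<omega> - z))\<^sup>2 / (2 * l)" for \<omega>
      using norm_clip_bias_le[OF l z, of "X \<omega>"] by (simp add: norm_minus_commute[of "X \<omega>" "clip (X \<omega>) l"])
  qed (use int int_clip int_sq in auto)
  also have "\<dots> \<le> v / (2 * l)"
    using var l by (simp add: divide_right_mono)
  finally show ?thesis .
qed

text \<open>The exponent lies in \<open>[0, 1]\<close> and therefore dominates its own square, so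
  twice its mean bounds both moments. This mean is at most \<open>A / (72 * N)\<close>, where 72 is
  216 / 3.\<close>

lemma exp_moment_extrapolation:
  assumes "0 < R" "1 \<le> A" "0 < b" "b \<le> a" "0 < N"
    and l_eq: "l = R / (20 * a * A)" and v: "a * b * v \<le> R\<^sup>2 / (216 * N)"
  shows "(\<integral>\<^sup>+\<omega>. ennreal (exp (A / R\<^sup>2 * (3 * (a * b) * (norm (z - clip (X \<omega>) l))\<^sup>2))) \<partial>M)
    \<le> ennreal (exp (A / (2 * N)))"
proof (rule exp_moment_le)
  let ?c = "A / R\<^sup>2 * (3 * (a * b))"
  let ?W = "\<lambda>\<omega>. (norm (z - clip (X \<omega>) l))\<^sup>2"
  have pos: "0 < a" "0 < A" "0 \<le> ?c"
    using assms by auto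
  have bound: "?c * ?W \<omega> \<le> 1" for \<omega>
  proof -
    \<comment> \<open>One factor \<open>b\<close> is raised to \<open>a\<close>, because the
      clipping level is inversely proportional to \<open>a\<close> and the two then cancel.\<close>
    have "?c * ?W \<omega> \<le> A / R\<^sup>2 * (3 * (a * a)) * (3 / 2 * l)\<^sup>2"
      using norm_clipped_noise_le[of \<omega>] assms pos
      by (intro mult_mono power_mono) (auto intro!: mult_left_mono)
    also have "\<dots> = 27 / (1600 * A)"
      using assms pos unfolding l_eq by (simp add: field_simps power2_eq_square)
    also have "\<dots> \<le> 1"
      using assms by simp
    finally show ?thesis .
  qed
  have nonneg: "0 \<le> ?c * ?W \<omega>" for \<omega>
    using pos assms by (intro mult_nonneg_nonneg) auto
  have Z: "A / R\<^sup>2 * (3 * (a * b) * ?W \<omega>) = ?c * ?W \<omega>" for \<omega>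
    by simp
  show "(\<lambda>\<omega>. A / R\<^sup>2 * (3 * (a * b) * ?W \<omega>)) \<in> borel_measurable M"
    by measurable
  show "\<bar>A / R\<^sup>2 * (3 * (a * b) * ?W \<omega>)\<bar> \<le> 1" for \<omega>
    unfolding Z using bound[of \<omega>] nonneg[of \<omega>] by linarith
  have E2: "expectation (\<lambda>\<omega>. (?c * ?W \<omega>)\<^sup>2) \<le> expectation (\<lambda>\<omega>. ?c * ?W \<omega>)"
  proof (rule integral_mono)
    show "(?c * ?W \<omega>)\<^sup>2 \<le> ?c * ?W \<omega>" for \<omega>
      unfolding power2_eq_square[of "?c * ?W \<omega>"] using bound nonneg by (rule mult_left_le)
    show "integrable M (\<lambda>\<omega>. (?c * ?W \<omega>)\<^sup>2)"
    proof (intro integrable_const_bound[where B = 1] AE_I2)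
      show "norm ((?c * ?W \<omega>)\<^sup>2) \<le> 1" for \<omega>
        using power_le_one[OF nonneg bound] by simp
    qed measurable
  qed (use integrable_clipped_noise in simp)
  have "expectation (\<lambda>\<omega>. ?c * ?W \<omega>) = ?c * expectation ?W"
    by (rule integral_mult_right_zero)
  also have "\<dots> \<le> ?c * v"
    using clipped_noise_second_moment pos by (intro mult_left_mono)
  also have "\<dots> = A / R\<^sup>2 * 3 * (a * b * v)"
    by simp
  also have "\<dots> \<le> A / R\<^sup>2 * 3 * (R\<^sup>2 / (216 * N))"
    using v pos by (intro mult_left_mono) auto
  also have "\<dots> = A / (72 * N)"
    using assms by simp
  finally have E1: "expectation (\<lambda>\<omega>. ?c * ?W \<omega>) \<le> A / (72 * N)" .
  have "A / (72 * N) + A / (72 * N) \<le> A / (2 * N)"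
    using assms pos by (simp add: field_simps)
  then show "expectation (\<lambda>\<omega>. A / R\<^sup>2 * (3 * (a * b) * ?W \<omega>))
      + expectation (\<lambda>\<omega>. (A / R\<^sup>2 * (3 * (a * b) * ?W \<omega>))\<^sup>2) \<le> A / (2 * N)"
    unfolding Z by (rule order_trans[OF add_mono[OF E1 order_trans[OF E2 E1]]])
qed

text \<open>The exponent is signed and linear in the error to first order. Its mean is small because
  the linear part contributes only the bias, and its square is small because \<open>b * norm\<close>
  of the error is bounded by a multiple of \<open>R\<close>; both estimates end in a multiple of
  \<open>b\<^sup>2 * v\<close>.\<close>

lemma exp_moment_update:
  assumes "0 < R" "1 \<le> A" "0 < b" "0 < N" and e: "norm e \<le> 3 * R"
    and l_eq: "l = R / (20 * b * A)" and v: "b\<^sup>2 * v \<le> R\<^sup>2 / (3240 * N * A)"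
  shows "(\<integral>\<^sup>+\<omega>. ennreal (exp (A / R\<^sup>2 * (2 * b * (e \<bullet> (z - clip (X \<omega>) l))
      + b\<^sup>2 * (norm (z - clip (X \<omega>) l))\<^sup>2))) \<partial>M) \<le> ennreal (exp (A / (2 * N)))"
proof (rule exp_moment_le)
  let ?t = "\<lambda>\<omega>. z - clip (X \<omega>) l"
  let ?Z = "\<lambda>\<omega>. A / R\<^sup>2 * (2 * b * (e \<bullet> ?t \<omega>) + b\<^sup>2 * (norm (?t \<omega>))\<^sup>2)"
  have pos: "0 < A"
    using assms by auto
  have tb: "b * norm (?t \<omega>) \<le> 3 * R / 40 / A" for \<omega>
  proof -
    have "b * norm (?t \<omega>) \<le> b * (3 / 2 * l)"
      using norm_clipped_noise_le assms by (intro mult_left_mono) auto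
    also have "\<dots> = 3 * R / 40 / A"
      using assms unfolding l_eq by simp
    finally show ?thesis .
  qed
  \<comment> \<open>The 7 is 6 + 1: the linear part gives \<open>2 * (3 * R)\<close>, and the
    quadratic part gives \<open>R\<close> since
    \<open>b * norm (?t \<omega>) \<le> R\<close>.\<close>
  have Zb: "\<bar>?Z \<omega>\<bar> \<le> 7 * A / R * (b * norm (?t \<omega>))" for \<omega>
  proof -
    have "3 * R / 40 / A \<le> R"
      using assms by (simp add: field_simps)
    then have "b * norm (?t \<omega>) \<le> R"
      using tb[of \<omega>] by linarith
    then have "(b * norm (?t \<omega>)) * (b * norm (?t \<omega>)) \<le> R * (b * norm (?t \<omega>))"
      using assms by (intro mult_right_mono) auto
    moreover have "\<bar>e \<bullet> ?t \<omega>\<bar> \<le> 3 * R * norm (?t \<omega>)"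
      using Cauchy_Schwarz_ineq2[of e "?t \<omega>"] mult_right_mono[OF e norm_ge_zero[of "?t \<omega>"]] by linarith
    then have "2 * b * \<bar>e \<bullet> ?t \<omega>\<bar> \<le> 2 * b * (3 * R * norm (?t \<omega>))"
      using assms by (intro mult_left_mono) auto
    moreover have "\<bar>2 * b * (e \<bullet> ?t \<omega>) + b\<^sup>2 * (norm (?t \<omega>))\<^sup>2\<bar>
        \<le> 2 * b * \<bar>e \<bullet> ?t \<omega>\<bar> + (b * norm (?t \<omega>)) * (b * norm (?t \<omega>))"
      using assms abs_triangle_ineq[of "2 * b * (e \<bullet> ?t \<omega>)" "b\<^sup>2 * (norm (?t \<omega>))\<^sup>2"]
      by (simp add: abs_mult power2_eq_square mult_ac)
    moreover have "2 * b * (3 * R * norm (?t \<omega>)) = 6 * (R * (b * norm (?t \<omega>)))"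
      "7 * R * (b * norm (?t \<omega>)) = 7 * (R * (b * norm (?t \<omega>)))"
      by simp_all
    ultimately have "\<bar>2 * b * (e \<bullet> ?t \<omega>) + b\<^sup>2 * (norm (?t \<omega>))\<^sup>2\<bar> \<le> 7 * R * (b * norm (?t \<omega>))"
      by linarith
    then have "A / R\<^sup>2 * \<bar>2 * b * (e \<bullet> ?t \<omega>) + b\<^sup>2 * (norm (?t \<omega>))\<^sup>2\<bar> \<le> A / R\<^sup>2 * (7 * R * (b * norm (?t \<omega>)))"
      using pos by (intro mult_left_mono) auto
    also have "\<dots> = 7 * A / R * (b * norm (?t \<omega>))"
      using assms by (simp add: power2_eq_square)
    finally show ?thesis
      using pos by (simp only: abs_mult[of "A / R\<^sup>2"]) simp
  qed
  show "?Z \<in> borel_measurable M"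
    by measurable
  show bound: "\<bar>?Z \<omega>\<bar> \<le> 1" for \<omega>
  proof -
    have "7 * A / R * (b * norm (?t \<omega>)) \<le> 7 * A / R * (3 * R / 40 / A)"
      using tb assms by (intro mult_left_mono) auto
    also have "\<dots> \<le> 1"
      using assms by simp
    finally show ?thesis
      using Zb[of \<omega>] by linarith
  qed
  note int_t = integrable_clipped_noise
  have "expectation ?Z = A / R\<^sup>2 * (2 * b * (e \<bullet> expectation ?t) + b\<^sup>2 * expectation (\<lambda>\<omega>. (norm (?t \<omega>))\<^sup>2))"
    using int_t by simp
  \<comment> \<open>The bias \<open>v / (2 * l)\<close> with \<open>l = R / (20 * b * A)\<close>
    turns \<open>6 * b * R\<close> into \<open>60 * A * b\<^sup>2\<close>, which produces the
    \<open>60 * A + 1\<close> below.\<close>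
  also have "\<dots> \<le> A / R\<^sup>2 * (2 * b * (3 * R * (v / (2 * l))) + b\<^sup>2 * v)"
  proof -
    have "e \<bullet> expectation ?t \<le> norm e * norm (expectation ?t)"
      by (rule norm_cauchy_schwarz)
    also have "\<dots> \<le> 3 * R * (v / (2 * l))"
      using e clipped_noise_bias assms by (intro mult_mono) auto
    finally show ?thesis
      using pos assms clipped_noise_second_moment by (intro mult_left_mono add_mono) auto
  qed
  also have "\<dots> = A / R\<^sup>2 * (60 * A + 1) * (b\<^sup>2 * v)"
    using assms unfolding l_eq by (simp add: field_simps power2_eq_square)
  finally have EZ: "expectation ?Z \<le> A / R\<^sup>2 * (60 * A + 1) * (b\<^sup>2 * v)" .
  have "expectation (\<lambda>\<omega>. (?Z \<omega>)\<^sup>2) \<le> expectation (\<lambda>\<omega>. 49 * A\<^sup>2 / R\<^sup>2 * b\<^sup>2 * (norm (?t \<omega>))\<^sup>2)"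
  proof (rule integral_mono)
    show "integrable M (\<lambda>\<omega>. (?Z \<omega>)\<^sup>2)"
      using bound by (intro integrable_const_bound[where B = 1]) (auto simp: abs_square_le_1)
    show "integrable M (\<lambda>\<omega>. 49 * A\<^sup>2 / R\<^sup>2 * b\<^sup>2 * (norm (?t \<omega>))\<^sup>2)"
      using int_t by simp
    fix \<omega>
    have "\<bar>?Z \<omega>\<bar>\<^sup>2 \<le> (7 * A / R * (b * norm (?t \<omega>)))\<^sup>2"
      using Zb[of \<omega>] by (intro power_mono) auto
    then show "(?Z \<omega>)\<^sup>2 \<le> 49 * A\<^sup>2 / R\<^sup>2 * b\<^sup>2 * (norm (?t \<omega>))\<^sup>2"
      by (simp only: power2_abs) (simp add: power_mult_distrib power_divide mult_ac)
  qed
  also have "\<dots> = 49 * A\<^sup>2 / R\<^sup>2 * b\<^sup>2 * expectation (\<lambda>\<omega>. (norm (?t \<omega>))\<^sup>2)"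
    by (rule integral_mult_right_zero)
  also have "\<dots> \<le> 49 * A\<^sup>2 / R\<^sup>2 * b\<^sup>2 * v"
    using clipped_noise_second_moment by (intro mult_left_mono) auto
  finally have EZ2: "expectation (\<lambda>\<omega>. (?Z \<omega>)\<^sup>2) \<le> 49 * A\<^sup>2 / R\<^sup>2 * b\<^sup>2 * v" .
  have "expectation ?Z + expectation (\<lambda>\<omega>. (?Z \<omega>)\<^sup>2) \<le> A / R\<^sup>2 * (109 * A + 1) * (b\<^sup>2 * v)"
  proof -
    have "A / R\<^sup>2 * (60 * A + 1) * (b\<^sup>2 * v) + 49 * A\<^sup>2 / R\<^sup>2 * b\<^sup>2 * v = A / R\<^sup>2 * (109 * A + 1) * (b\<^sup>2 * v)"
      using assms by (simp add: field_simps power2_eq_square)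
    then show ?thesis
      using EZ EZ2 by linarith
  qed
  \<comment> \<open>Here 109 = 60 + 49, where 49 is the square of the 7 above. As
    \<open>1 \<le> A\<close>, the result is at most \<open>110 * A / (3240 * N)\<close>, well below
    \<open>A / (2 * N)\<close>.\<close>
  also have "\<dots> \<le> A / R\<^sup>2 * (109 * A + 1) * (R\<^sup>2 / (3240 * N * A))"
    using v assms pos by (intro mult_left_mono) auto
  also have "\<dots> = (109 * A + 1) / (3240 * N)"
    using assms pos by (simp add: field_simps)
  also have "\<dots> \<le> A / (2 * N)"
    using assms pos by (simp add: field_simps)
  finally show "expectation ?Z + expectation (\<lambda>\<omega>. (?Z \<omega>)\<^sup>2) \<le> A / (2 * N)" .
qed

end

end

section \<open>Integration with an independent variable frozen\<close>

text \<open>Fubini on the product of the two distributions takes the place of conditional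
  expectation: a bound for every fixed past \<open>x\<close> carries over to the random past
  \<open>X\<close>.\<close>

lemma (in prob_space) nn_integral_indep_le:
  assumes indep: "indep_var S X T Y" and f: "f \<in> borel_measurable (S \<Otimes>\<^sub>M T)"
    and le: "\<And>x. x \<in> space S \<Longrightarrow> (\<integral>\<^sup>+\<omega>. f (x, Y \<omega>) \<partial>M) \<le> g x"
  shows "(\<integral>\<^sup>+\<omega>. f (X \<omega>, Y \<omega>) \<partial>M) \<le> (\<integral>\<^sup>+\<omega>. g (X \<omega>) \<partial>M)"
proof -
  note [measurable] = f
  have X[measurable]: "X \<in> measurable M S" and Y[measurable]: "Y \<in> measurable M T"
    and eq: "distr M S X \<Otimes>\<^sub>M distr M T Y = distr M (S \<Otimes>\<^sub>M T) (\<lambda>\<omega>. (X \<omega>, Y \<omega>))"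
    using indep by (auto simp: indep_var_distribution_eq)
  interpret T: prob_space "distr M T Y"
    by (rule prob_space_distr) fact
  have "(\<integral>\<^sup>+\<omega>. f (X \<omega>, Y \<omega>) \<partial>M) = (\<integral>\<^sup>+z. f z \<partial>(distr M S X \<Otimes>\<^sub>M distr M T Y))"
    unfolding eq by (subst nn_integral_distr) auto
  also have "\<dots> = (\<integral>\<^sup>+x. \<integral>\<^sup>+y. f (x, y) \<partial>distr M T Y \<partial>distr M S X)"
    by (rule T.nn_integral_fst[symmetric]) simp
  also have "\<dots> = (\<integral>\<^sup>+\<omega>. \<integral>\<^sup>+y. f (X \<omega>, y) \<partial>distr M T Y \<partial>M)"
    by (subst nn_integral_distr) auto
  also have "\<dots> \<le> (\<integral>\<^sup>+\<omega>. g (X \<omega>) \<partial>M)"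
  proof (rule nn_integral_mono)
    fix \<omega>
    assume "\<omega> \<in> space M"
    then have "X \<omega> \<in> space S"
      using X by (rule measurable_space[rotated])
    then show "(\<integral>\<^sup>+y. f (X \<omega>, y) \<partial>distr M T Y) \<le> g (X \<omega>)"
      using le by (subst nn_integral_distr) auto
  qed
  finally show ?thesis .
qed

lemma measurable_minibatch:
  fixes G :: "'b::euclidean_space \<Rightarrow> 's \<Rightarrow> 'b"
  assumes G: "(\<lambda>(x, s). G x s) \<in> borel_measurable (borel \<Otimes>\<^sub>M D)"
    and h: "h \<in> borel_measurable S" and t: "\<And>i. i \<in> {1..m} \<Longrightarrow> (\<lambda>z. t z i) \<in> measurable S D"
  shows "(\<lambda>z. minibatch G m (t z) (h z)) \<in> borel_measurable S"
proof -
  have "(\<lambda>z. G (h z) (t z i)) \<in> borel_measurable S" if "i \<in> {1..m}" for i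
    using measurable_compose[OF measurable_Pair[OF h t[OF that]] G] by simp
  then show ?thesis
    unfolding minibatch_def by (intro borel_measurable_scaleR borel_measurable_const borel_measurable_sum)
qed

section \<open>The stochastic process, its noise and its dependence on the samples\<close>

text \<open>Both kinds of samples form one family over a sum type, so that a single independence
  assumption covers them. In the theorem \<open>A\<close> becomes the logarithm and \<open>N\<close>
  becomes \<open>K + 1\<close>; \<open>var1\<close> and \<open>var2\<close> restate the batch sizes
  as bounds on minibatch variances.\<close>

locale clipped_SEG_process = prob_space M for M :: "'w measure" +
  fixes D :: "'s measure" and G :: "'a::euclidean_space \<Rightarrow> 's \<Rightarrow> 'a" and F :: "'a \<Rightarrow> 'a"
    and \<xi> :: "(nat \<times> nat) + (nat \<times> nat) \<Rightarrow> 'w \<Rightarrow> 's"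
    and x0 xs :: 'a and R L \<rho> \<sigma> A N \<gamma>1 \<gamma>2 lam1 lam2 :: real and m1 m2 :: nat
  assumes unbiased: "stochastic_oracle D G F"
    and indep: "indep_vars (\<lambda>_. D) \<xi> (UNIV \<times> {1..m1} <+> UNIV \<times> {1..m2})"
    and distr: "\<And>j. j \<in> UNIV \<times> {1..m1} <+> UNIV \<times> {1..m2} \<Longrightarrow> distr M D (\<xi> j) = D"
    and solution: "xs \<in> solutions F" and start: "norm (x0 - xs) \<le> R"
    and var: "bounded_variance_on (cball xs (3 * R)) D G F \<sigma>"
    and lipschitz: "L-lipschitz_on (cball xs (3 * R)) F"
    and comonotone: "star_negative_comonotone_on (cball xs (3 * R)) F \<rho>"
    and R: "0 < R" and L: "0 < L" and \<rho>: "0 \<le> \<rho>" and A: "1 \<le> A" and N: "0 < N"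
    and \<gamma>2: "0 < \<gamma>2" and \<gamma>12: "\<gamma>2 + 2 * \<rho> \<le> \<gamma>1" and \<gamma>1: "\<gamma>1 \<le> 1 / (160 * L * A)"
    and lam1: "lam1 = R / (20 * \<gamma>1 * A)" and lam2: "lam2 = R / (20 * \<gamma>2 * A)"
    and m1: "0 < m1" and var1: "\<gamma>1 * \<gamma>2 * (\<sigma>\<^sup>2 / real m1) \<le> R\<^sup>2 / (216 * N)"
    and m2: "0 < m2" and var2: "\<gamma>2\<^sup>2 * (\<sigma>\<^sup>2 / real m2) \<le> R\<^sup>2 / (3240 * N * A)"
begin

text \<open>The argument is a realized sample family instead of an outcome, so the same function can
  be evaluated on the restriction of the family to past indices.\<close>

definition iterate :: "nat \<Rightarrow> ((nat \<times> nat) + (nat \<times> nat) \<Rightarrow> 's) \<Rightarrow> 'a" where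
  "iterate k p = clipped_SEG G \<gamma>1 \<gamma>2 (\<lambda>_. lam1) (\<lambda>_. lam2) (\<lambda>_. m1) (\<lambda>_. m2) x0
     (\<lambda>j i. p (Inl (j, i))) (\<lambda>j i. p (Inr (j, i))) k"

definition extrapolate :: "'a \<Rightarrow> (nat \<Rightarrow> 's) \<Rightarrow> 'a" where
  "extrapolate x s = x - \<gamma>1 *\<^sub>R clip (minibatch G m1 s x) lam1"

text \<open>\<open>noise1\<close> and \<open>noise2\<close> are the error terms of
  \<open>extragradient_step\<close>, the first from the extrapolation and the second from the
  update.\<close>

definition noise1 :: "'a \<Rightarrow> (nat \<Rightarrow> 's) \<Rightarrow> real" where
  "noise1 x s = 3 * (\<gamma>1 * \<gamma>2) * (norm (F x - clip (minibatch G m1 s x) lam1))\<^sup>2"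

definition noise2 :: "'a \<Rightarrow> 'a \<Rightarrow> (nat \<Rightarrow> 's) \<Rightarrow> real" where
  "noise2 x y s =
     2 * \<gamma>2 * ((x - xs - \<gamma>2 *\<^sub>R F y) \<bullet> (F y - clip (minibatch G m2 s y) lam2))
     + \<gamma>2\<^sup>2 * (norm (F y - clip (minibatch G m2 s y) lam2))\<^sup>2"

text \<open>Radius \<open>2 * R\<close> leaves room for the extrapolation step to remain in the ball
  of radius \<open>3 * R\<close>, where the assumptions on \<open>F\<close> hold.\<close>

definition near :: "'a \<Rightarrow> bool" where
  "near x \<longleftrightarrow> norm (x - xs) \<le> 2 * R"

text \<open>The indicator acts as stopping without conditioning: whether iteration \<open>j\<close>
  is counted is decided by the samples of earlier iterations alone.\<close>

definition total_noise :: "nat \<Rightarrow> ((nat \<times> nat) + (nat \<times> nat) \<Rightarrow> 's) \<Rightarrow> real" where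
  "total_noise k p = (\<Sum>j<k. if near (iterate j p)
     then noise1 (iterate j p) (\<lambda>i. p (Inl (j, i)))
        + noise2 (iterate j p) (extrapolate (iterate j p) (\<lambda>i. p (Inl (j, i)))) (\<lambda>i. p (Inr (j, i)))
     else 0)"

text \<open>Two counters are kept because after the extrapolation half of iteration \<open>k\<close>
  the samples drawn are those of \<open>past (Suc k) k\<close>.\<close>

definition past :: "nat \<Rightarrow> nat \<Rightarrow> ((nat \<times> nat) + (nat \<times> nat)) set" where
  "past a b = {..<a} \<times> {1..m1} <+> {..<b} \<times> {1..m2}"

lemma in_past [simp]:
  "Inl (j, i) \<in> past a b \<longleftrightarrow> j < a \<and> i \<in> {1..m1}" "Inr (j, i) \<in> past a b \<longleftrightarrow> j < b \<and> i \<in> {1..m2}"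
  by (auto simp: past_def)

lemma iterate_0: "iterate 0 p = x0"
  by (simp add: iterate_def)

lemma iterate_Suc:
  "iterate (Suc k) p = iterate k p - \<gamma>2 *\<^sub>R clip (minibatch G m2 (\<lambda>i. p (Inr (k, i)))
     (extrapolate (iterate k p) (\<lambda>i. p (Inl (k, i))))) lam2"
  by (simp add: iterate_def extrapolate_def Let_def)

lemma minibatch_cong:
  "(\<And>i. i \<in> {1..m} \<Longrightarrow> s i = t i) \<Longrightarrow> minibatch G m s x = minibatch G m t x"
  by (simp add: minibatch_def)

lemma extrapolate_cong:
  "(\<And>i. i \<in> {1..m1} \<Longrightarrow> s i = t i) \<Longrightarrow> extrapolate x s = extrapolate x t"
  unfolding extrapolate_def by (metis minibatch_cong)

lemma noise1_cong: "(\<And>i. i \<in> {1..m1} \<Longrightarrow> s i = t i) \<Longrightarrow> noise1 x s = noise1 x t"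
  unfolding noise1_def by (metis minibatch_cong)

lemma noise2_cong: "(\<And>i. i \<in> {1..m2} \<Longrightarrow> s i = t i) \<Longrightarrow> noise2 x y s = noise2 x y t"
  unfolding noise2_def by (metis minibatch_cong)

text \<open>Restricting the family to \<open>past k k\<close> makes it \<open>undefined\<close>
  elsewhere; this lemma shows that the iterate does not notice.\<close>

lemma iterate_cong: "(\<And>j. j \<in> past k k \<Longrightarrow> p j = q j) \<Longrightarrow> iterate k p = iterate k q"
proof (induction k)
  case (Suc k)
  have it: "iterate k p = iterate k q"
    by (rule Suc.IH, rule Suc.prems) (auto simp: past_def)
  have ex: "extrapolate x (\<lambda>i. p (Inl (k, i))) = extrapolate x (\<lambda>i. q (Inl (k, i)))" for x
    by (intro extrapolate_cong Suc.prems) simp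
  have mb: "minibatch G m2 (\<lambda>i. p (Inr (k, i))) x = minibatch G m2 (\<lambda>i. q (Inr (k, i))) x" for x
    by (intro minibatch_cong Suc.prems) simp
  show ?case
    unfolding iterate_Suc it ex mb ..
qed (simp add: iterate_0)

lemma total_noise_cong:
  assumes "\<And>j. j \<in> past k k \<Longrightarrow> p j = q j"
  shows "total_noise k p = total_noise k q"
  unfolding total_noise_def
proof (rule sum.cong[OF refl])
  fix j
  assume "j \<in> {..<k}"
  then have j: "j < k"
    by simp
  have it: "iterate j p = iterate j q"
    using j by (intro iterate_cong assms) (auto simp: past_def)
  have ex: "extrapolate x (\<lambda>i. p (Inl (j, i))) = extrapolate x (\<lambda>i. q (Inl (j, i)))"
    and n1: "noise1 x (\<lambda>i. p (Inl (j, i))) = noise1 x (\<lambda>i. q (Inl (j, i)))" for x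
    using j by (intro extrapolate_cong noise1_cong assms; simp)+
  have n2: "noise2 x y (\<lambda>i. p (Inr (j, i))) = noise2 x y (\<lambda>i. q (Inr (j, i)))" for x y
    using j by (intro noise2_cong assms) simp
  show "(if near (iterate j p)
     then noise1 (iterate j p) (\<lambda>i. p (Inl (j, i)))
        + noise2 (iterate j p) (extrapolate (iterate j p) (\<lambda>i. p (Inl (j, i)))) (\<lambda>i. p (Inr (j, i)))
     else 0) = (if near (iterate j q)
     then noise1 (iterate j q) (\<lambda>i. q (Inl (j, i)))
        + noise2 (iterate j q) (extrapolate (iterate j q) (\<lambda>i. q (Inl (j, i)))) (\<lambda>i. q (Inr (j, i)))
     else 0)"
    unfolding it ex n1 n2 ..
qed

lemma measurable_oracle [measurable]: "(\<lambda>(x, s). G x s) \<in> borel_measurable (borel \<Otimes>\<^sub>M D)"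
  using unbiased by (simp add: stochastic_oracle_def)

text \<open>\<open>F\<close> is the integral of a jointly measurable oracle over its second
  argument.\<close>

lemma measurable_F [measurable]: "F \<in> borel_measurable borel"
proof -
  interpret D: prob_space D
    using unbiased by (simp add: stochastic_oracle_def)
  have "F = (\<lambda>x. \<integral>s. G x s \<partial>D)"
    using unbiased by (auto simp: stochastic_oracle_def has_bochner_integral_iff fun_eq_iff)
  moreover have "(\<lambda>x. \<integral>s. G x s \<partial>D) \<in> borel_measurable borel"
    by (rule D.borel_measurable_lebesgue_integral) (rule measurable_oracle)
  ultimately show ?thesis
    by simp
qed

lemma measurable_near [measurable]: "Measurable.pred borel near"
  unfolding near_def by measurable

lemma measurable_extrapolate:
  assumes h: "h \<in> borel_measurable S" and t: "\<And>i. i \<in> {1..m1} \<Longrightarrow> (\<lambda>z. t z i) \<in> measurable S D"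
  shows "(\<lambda>z. extrapolate (h z) (t z)) \<in> borel_measurable S"
proof -
  note [measurable] = h measurable_minibatch[where m = m1, OF measurable_oracle h t]
  show ?thesis
    unfolding extrapolate_def by measurable
qed

lemma measurable_noise1:
  assumes h: "h \<in> borel_measurable S" and t: "\<And>i. i \<in> {1..m1} \<Longrightarrow> (\<lambda>z. t z i) \<in> measurable S D"
  shows "(\<lambda>z. noise1 (h z) (t z)) \<in> borel_measurable S"
proof -
  note [measurable] = h measurable_minibatch[where m = m1, OF measurable_oracle h t]
  show ?thesis
    unfolding noise1_def by measurable
qed

lemma measurable_noise2:
  assumes h: "h \<in> borel_measurable S" and g: "g \<in> borel_measurable S"
    and t: "\<And>i. i \<in> {1..m2} \<Longrightarrow> (\<lambda>z. t z i) \<in> measurable S D"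
  shows "(\<lambda>z. noise2 (h z) (g z) (t z)) \<in> borel_measurable S"
proof -
  note [measurable] = h g measurable_minibatch[where m = m2, OF measurable_oracle g t]
  show ?thesis
    unfolding noise2_def by measurable
qed

text \<open>The source space \<open>S\<close> is arbitrary because the lemma serves both the
  underlying probability space and products of sample spaces.\<close>

lemma measurable_iterate:
  assumes "\<And>j. j \<in> past k k \<Longrightarrow> (\<lambda>z. p z j) \<in> measurable S D"
  shows "(\<lambda>z. iterate k (p z)) \<in> borel_measurable S"
  using assms
proof (induction k)
  case (Suc k)
  have it[measurable]: "(\<lambda>z. iterate k (p z)) \<in> borel_measurable S"
    by (rule Suc.IH, rule Suc.prems) (auto simp: past_def)
  have ex: "(\<lambda>z. extrapolate (iterate k (p z)) (\<lambda>i. p z (Inl (k, i)))) \<in> borel_measurable S"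
    by (rule measurable_extrapolate[OF it], rule Suc.prems) simp
  have [measurable]: "(\<lambda>z. minibatch G m2 (\<lambda>i. p z (Inr (k, i)))
      (extrapolate (iterate k (p z)) (\<lambda>i. p z (Inl (k, i))))) \<in> borel_measurable S"
    by (rule measurable_minibatch[OF measurable_oracle ex], rule Suc.prems) simp
  show ?case
    unfolding iterate_Suc by measurable
qed (simp add: iterate_0)

lemma measurable_total_noise:
  assumes p: "\<And>j. j \<in> past k k \<Longrightarrow> (\<lambda>z. p z j) \<in> measurable S D"
  shows "(\<lambda>z. total_noise k (p z)) \<in> borel_measurable S"
  unfolding total_noise_def
proof (rule borel_measurable_sum)
  fix j
  assume "j \<in> {..<k}"
  then have j: "j < k"
    by simp
  have it[measurable]: "(\<lambda>z. iterate j (p z)) \<in> borel_measurable S"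
    using j by (intro measurable_iterate p) (auto simp: past_def)
  have ex: "(\<lambda>z. extrapolate (iterate j (p z)) (\<lambda>i. p z (Inl (j, i)))) \<in> borel_measurable S"
    using j by (intro measurable_extrapolate it p) simp
  have [measurable]: "(\<lambda>z. noise1 (iterate j (p z)) (\<lambda>i. p z (Inl (j, i)))) \<in> borel_measurable S"
    using j by (intro measurable_noise1 it p) simp
  have [measurable]: "(\<lambda>z. noise2 (iterate j (p z)) (extrapolate (iterate j (p z)) (\<lambda>i. p z (Inl (j, i))))
      (\<lambda>i. p z (Inr (j, i)))) \<in> borel_measurable S"
    using j by (intro measurable_noise2 it ex p) simp
  show "(\<lambda>z. if near (iterate j (p z))
     then noise1 (iterate j (p z)) (\<lambda>i. p z (Inl (j, i)))
        + noise2 (iterate j (p z)) (extrapolate (iterate j (p z)) (\<lambda>i. p z (Inl (j, i)))) (\<lambda>i. p z (Inr (j, i)))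
     else 0) \<in> borel_measurable S"
    by measurable
qed

section \<open>Consequences of the parameter choices near the solution\<close>

lemma \<gamma>_pos: "0 < \<gamma>1" "\<gamma>2 \<le> \<gamma>1"
  using \<rho> \<gamma>2 \<gamma>12 by auto

lemma lam_pos: "0 < lam1" "0 < lam2"
  using R A \<gamma>2 \<gamma>_pos by (auto simp: lam1 lam2)

lemma norm_extrapolate:
  assumes "near x"
  shows "norm (extrapolate x s - xs) \<le> 3 * R"
proof -
  have "norm (extrapolate x s - xs) \<le> norm (x - xs) + norm (\<gamma>1 *\<^sub>R clip (minibatch G m1 s x) lam1)"
    unfolding extrapolate_def
    using norm_triangle_ineq4[of "x - xs" "\<gamma>1 *\<^sub>R clip (minibatch G m1 s x) lam1"] by (simp add: algebra_simps)
  also have "\<dots> \<le> 2 * R + \<gamma>1 * lam1"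
    using assms \<gamma>_pos norm_clip_le[OF lam_pos(1)] by (intro add_mono) (auto simp: near_def)
  also have "\<gamma>1 * lam1 \<le> R"
    using R A \<gamma>_pos by (simp add: lam1 field_simps)
  finally show ?thesis
    by simp
qed

lemma near_in_cball: "near x \<Longrightarrow> x \<in> cball xs (3 * R)"
  using R by (simp add: near_def dist_norm norm_minus_commute)

lemma extrapolate_in_cball: "near x \<Longrightarrow> extrapolate x s \<in> cball xs (3 * R)"
  using norm_extrapolate[of x s] by (simp add: dist_norm norm_minus_commute)

text \<open>Since \<open>F xs = 0\<close>, the Lipschitz bound gives at most
  \<open>3 * L * R\<close>, while the bound on \<open>\<gamma>1\<close> makes
  \<open>lam1 / 2\<close> at least \<open>4 * L * R\<close>. This places the true operator value
  within half the clipping level, as the bias bound requires.\<close>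

lemma norm_F_le:
  assumes "x \<in> cball xs (3 * R)"
  shows "norm (F x) \<le> lam1 / 2" "norm (F x) \<le> lam2 / 2"
proof -
  have "norm (F x) = dist (F x) (F xs)"
    using solution by (simp add: solutions_def)
  also have "\<dots> \<le> L * dist x xs"
    using lipschitz assms R by (intro lipschitz_onD) auto
  also have "\<dots> \<le> L * (3 * R)"
    using assms L by (intro mult_left_mono) (auto simp: dist_commute)
  also have "\<dots> \<le> lam1 / 2"
  proof -
    have "\<gamma>1 * (160 * L * A) \<le> 1"
      using \<gamma>1 L A by (simp add: field_simps)
    then have "R * (\<gamma>1 * (160 * L * A)) \<le> R * 1"
      using R by (intro mult_left_mono) auto
    then have "L * (3 * R) * (40 * \<gamma>1 * A) \<le> R"
      using R L A \<gamma>_pos by (simp add: algebra_simps)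
    then show ?thesis
      using A \<gamma>_pos by (simp add: lam1 field_simps)
  qed
  finally show le: "norm (F x) \<le> lam1 / 2" .
  have "lam1 \<le> lam2"
    unfolding lam1 lam2 using R A \<gamma>2 \<gamma>_pos by (intro divide_left_mono mult_right_mono) auto
  then show "norm (F x) \<le> lam2 / 2"
    using le by simp
qed

text \<open>An instance of \<open>extragradient_step\<close>: both \<open>x\<close> and the
  extrapolated point lie in the large ball, and \<open>L * \<gamma>1 \<le> 1 / 2\<close> converts
  the Lipschitz bound into the required comparison with the clipped step.\<close>

lemma noise_step:
  assumes "near x"
  shows "(norm (x - \<gamma>2 *\<^sub>R clip (minibatch G m2 s' (extrapolate x s)) lam2 - xs))\<^sup>2
      + \<gamma>1 * \<gamma>2 / 4 * (norm (F x))\<^sup>2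
    \<le> (norm (x - xs))\<^sup>2 + noise1 x s + noise2 x (extrapolate x s) s'"
proof -
  let ?w = "clip (minibatch G m1 s x) lam1" and ?y = "extrapolate x s"
  have "F ?y \<bullet> (x - \<gamma>1 *\<^sub>R ?w - xs) \<ge> - \<rho> * (norm (F ?y))\<^sup>2"
    using comonotone solution extrapolate_in_cball[OF assms, of s]
    by (auto simp: star_negative_comonotone_on_def extrapolate_def)
  moreover have "norm (F x - F ?y) \<le> norm ?w / 2"
  proof -
    have "norm (F x - F ?y) \<le> L * norm (x - ?y)"
      using lipschitz_onD[OF lipschitz near_in_cball extrapolate_in_cball] assms by (simp add: dist_norm)
    also have "\<dots> = L * \<gamma>1 * norm ?w"
      using \<gamma>_pos by (simp add: extrapolate_def)
    also have "\<dots> \<le> 1 / 2 * norm ?w"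
    proof (rule mult_right_mono)
      have "1 / (160 * L * A) \<le> 1 / (160 * L)"
        using L A by (simp add: field_simps)
      with \<gamma>1 have "\<gamma>1 \<le> 1 / (160 * L)"
        by (rule order_trans)
      then show "L * \<gamma>1 \<le> 1 / 2"
        using L by (simp add: field_simps)
    qed simp
    finally show ?thesis
      by simp
  qed
  ultimately show ?thesis
    using extragradient_step[of \<gamma>2 \<gamma>1 \<rho> "F ?y" x ?w xs "F x" "clip (minibatch G m2 s' ?y) lam2"] \<gamma>2 \<gamma>12 \<gamma>_pos
    by (simp add: noise1_def noise2_def)
qed

section \<open>Exponential moment of the accumulated noise\<close>

lemma measurable_sample:
  assumes "j \<in> UNIV \<times> {1..m1} <+> UNIV \<times> {1..m2}"
  shows "\<xi> j \<in> measurable M D"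
  using indep assms by (auto simp: indep_vars_def)

lemma bounded_variance_at:
  "x \<in> cball xs (3 * R) \<Longrightarrow> (\<integral>\<^sup>+s. ennreal ((norm (G x s - F x))\<^sup>2) \<partial>D) \<le> ennreal (\<sigma>\<^sup>2)"
  using var by (simp add: bounded_variance_on_def)

lemma exp_noise1_le:
  assumes "near x"
  shows "(\<integral>\<^sup>+\<omega>. ennreal (exp (A / R\<^sup>2 * noise1 x (\<lambda>i. \<xi> (Inl (k, i)) \<omega>))) \<partial>M) \<le> ennreal (exp (A / (2 * N)))"
proof -
  have sub: "(\<lambda>i. Inl (k, i)) ` {1..m1} \<subseteq> UNIV \<times> {1..m1} <+> UNIV \<times> {1..m2}"
    by auto
  have inj: "inj_on (\<lambda>i. Inl (k, i)) {1..m1}"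
    by (auto simp: inj_on_def)
  note mom = minibatch_moments[where \<xi> = \<xi> and \<iota> = "\<lambda>i. Inl (k, i)" and x = x, OF unbiased
      inj indep_vars_subset[OF indep sub] distr[OF subsetD[OF sub]] m1
      bounded_variance_at[OF near_in_cball[OF assms]] zero_le_power2]
  show ?thesis
    unfolding noise1_def
    by (rule exp_moment_extrapolation[OF mom lam_pos(1) norm_F_le(1)[OF near_in_cball[OF assms]]
          R A \<gamma>2 \<gamma>_pos(2) N lam1 var1])
qed

text \<open>Here \<open>x\<close> and \<open>y\<close> are frozen, so only the update batch is
  random and its minibatch is unbiased for \<open>F y\<close>. In \<open>extragradient_step\<close>
  terms, the vector paired with the error is then a constant of norm at most
  \<open>3 * R\<close>.\<close>

lemma exp_noise2_le:
  assumes "near x" "y \<in> cball xs (3 * R)"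
  shows "(\<integral>\<^sup>+\<omega>. ennreal (exp (A / R\<^sup>2 * noise2 x y (\<lambda>i. \<xi> (Inr (k, i)) \<omega>))) \<partial>M) \<le> ennreal (exp (A / (2 * N)))"
proof -
  have sub: "(\<lambda>i. Inr (k, i)) ` {1..m2} \<subseteq> UNIV \<times> {1..m1} <+> UNIV \<times> {1..m2}"
    by auto
  have inj: "inj_on (\<lambda>i. Inr (k, i)) {1..m2}"
    by (auto simp: inj_on_def)
  note mom = minibatch_moments[where \<xi> = \<xi> and \<iota> = "\<lambda>i. Inr (k, i)" and x = y, OF unbiased
      inj indep_vars_subset[OF indep sub] distr[OF subsetD[OF sub]] m2
      bounded_variance_at[OF assms(2)] zero_le_power2]
  have e: "norm (x - xs - \<gamma>2 *\<^sub>R F y) \<le> 3 * R"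
  proof -
    have "norm (x - xs - \<gamma>2 *\<^sub>R F y) \<le> norm (x - xs) + norm (\<gamma>2 *\<^sub>R F y)"
      by (rule norm_triangle_ineq4)
    also have "\<dots> \<le> 2 * R + \<gamma>2 * (lam2 / 2)"
      using assms \<gamma>2 norm_F_le(2)[OF assms(2)] by (intro add_mono) (auto simp: near_def)
    also have "\<gamma>2 * (lam2 / 2) \<le> R"
      using R A \<gamma>2 by (simp add: lam2 field_simps)
    finally show ?thesis
      by simp
  qed
  show ?thesis
    unfolding noise2_def
    by (rule exp_moment_update[OF mom lam_pos(2) norm_F_le(2)[OF assms(2)] R A \<gamma>2 N e lam2 var2])
qed

lemma past_subset: "past a b \<subseteq> UNIV \<times> {1..m1} <+> UNIV \<times> {1..m2}"
  by (auto simp: past_def)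

lemma exp_total_noise_half_step1:
  "(\<integral>\<^sup>+\<omega>. ennreal (exp (A / R\<^sup>2 * (total_noise k (\<lambda>j. \<xi> j \<omega>)
      + (if near (iterate k (\<lambda>j. \<xi> j \<omega>))
         then noise1 (iterate k (\<lambda>j. \<xi> j \<omega>)) (\<lambda>i. \<xi> (Inl (k, i)) \<omega>) else 0)))) \<partial>M)
    \<le> (\<integral>\<^sup>+\<omega>. ennreal (exp (A / R\<^sup>2 * total_noise k (\<lambda>j. \<xi> j \<omega>))) \<partial>M) * ennreal (exp (A / (2 * N)))"
proof -
  let ?c = "A / R\<^sup>2"
  let ?B = "(\<lambda>i. Inl (k, i)) ` {1..m1} :: ((nat \<times> nat) + (nat \<times> nat)) set"
  let ?S = "PiM (past k k) (\<lambda>_. D)" and ?T = "PiM ?B (\<lambda>_. D)"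
  define X where "X \<omega> = restrict (\<lambda>j. \<xi> j \<omega>) (past k k)" for \<omega>
  define Y where "Y \<omega> = restrict (\<lambda>j. \<xi> j \<omega>) ?B" for \<omega>
  define f :: "((nat \<times> nat) + (nat \<times> nat) \<Rightarrow> 's) \<times> ((nat \<times> nat) + (nat \<times> nat) \<Rightarrow> 's) \<Rightarrow> ennreal"
    where "f = (\<lambda>(p, s). ennreal (exp (?c * (total_noise k p
      + (if near (iterate k p) then noise1 (iterate k p) (\<lambda>i. s (Inl (k, i))) else 0)))))"
  define g where "g p = ennreal (exp (?c * total_noise k p)) * ennreal (exp (A / (2 * N)))" for p
  have ind: "indep_var ?S X ?T Y"
    unfolding X_def Y_def by (rule indep_var_restrict[OF indep]) (auto simp: past_def)
  have fst': "(\<lambda>z. fst z j) \<in> measurable (?S \<Otimes>\<^sub>M ?T) D" if "j \<in> past k k" for j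
    using that by measurable
  have snd': "(\<lambda>z. snd z (Inl (k, i))) \<in> measurable (?S \<Otimes>\<^sub>M ?T) D" if "i \<in> {1..m1}" for i
    using that by (intro measurable_compose[OF measurable_snd measurable_component_singleton]) auto
  have it[measurable]: "(\<lambda>z. iterate k (fst z)) \<in> borel_measurable (?S \<Otimes>\<^sub>M ?T)"
    and [measurable]: "(\<lambda>z. total_noise k (fst z)) \<in> borel_measurable (?S \<Otimes>\<^sub>M ?T)"
    by (intro measurable_iterate measurable_total_noise fst'; assumption)+
  have [measurable]: "(\<lambda>z. noise1 (iterate k (fst z)) (\<lambda>i. snd z (Inl (k, i)))) \<in> borel_measurable (?S \<Otimes>\<^sub>M ?T)"
    by (intro measurable_noise1 it snd')
  have f: "f \<in> borel_measurable (?S \<Otimes>\<^sub>M ?T)"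
    unfolding f_def case_prod_beta by measurable
  have Yn: "noise1 x (\<lambda>i. Y \<omega> (Inl (k, i))) = noise1 x (\<lambda>i. \<xi> (Inl (k, i)) \<omega>)" for x \<omega>
    by (rule noise1_cong) (simp add: Y_def)
  have le: "(\<integral>\<^sup>+\<omega>. f (p, Y \<omega>) \<partial>M) \<le> g p" for p
  proof (cases "near (iterate k p)")
    case True
    have [measurable]: "(\<lambda>\<omega>. noise1 (iterate k p) (\<lambda>i. \<xi> (Inl (k, i)) \<omega>)) \<in> borel_measurable M"
      by (intro measurable_noise1 measurable_sample) auto
    have "f (p, Y \<omega>) = ennreal (exp (?c * total_noise k p))
        * ennreal (exp (?c * noise1 (iterate k p) (\<lambda>i. \<xi> (Inl (k, i)) \<omega>)))" for \<omega>
      using True by (simp add: f_def Yn distrib_left exp_add ennreal_mult)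
    then have "(\<integral>\<^sup>+\<omega>. f (p, Y \<omega>) \<partial>M) = ennreal (exp (?c * total_noise k p))
        * (\<integral>\<^sup>+\<omega>. ennreal (exp (?c * noise1 (iterate k p) (\<lambda>i. \<xi> (Inl (k, i)) \<omega>))) \<partial>M)"
      by (simp add: nn_integral_cmult)
    then show ?thesis
      using exp_noise1_le[OF True] by (simp add: g_def mult_left_mono)
  next
    case False
    \<comment> \<open>No noise is counted here, and the factor granted by the claim is at least
      1.\<close>
    have "exp (?c * total_noise k p) * 1 \<le> exp (?c * total_noise k p) * exp (A / (2 * N))"
      using A N by (intro mult_left_mono) auto
    then show ?thesis
      using False by (simp add: f_def g_def emeasure_space_1 flip: ennreal_mult)
  qed
  have tn: "total_noise k (X \<omega>) = total_noise k (\<lambda>j. \<xi> j \<omega>)"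
    and itX: "iterate k (X \<omega>) = iterate k (\<lambda>j. \<xi> j \<omega>)" for \<omega>
    by (intro total_noise_cong iterate_cong; simp add: X_def)+
  have [measurable]: "(\<lambda>\<omega>. total_noise k (\<lambda>j. \<xi> j \<omega>)) \<in> borel_measurable M"
    using past_subset by (intro measurable_total_noise measurable_sample) auto
  have "(\<integral>\<^sup>+\<omega>. f (X \<omega>, Y \<omega>) \<partial>M) \<le> (\<integral>\<^sup>+\<omega>. g (X \<omega>) \<partial>M)"
    by (rule nn_integral_indep_le[OF ind f le])
  then show ?thesis
    by (simp add: f_def g_def tn itX Yn nn_integral_multc cong: if_cong)
qed

lemma exp_total_noise_half_step2:
  "(\<integral>\<^sup>+\<omega>. ennreal (exp (A / R\<^sup>2 * total_noise (Suc k) (\<lambda>j. \<xi> j \<omega>))) \<partial>M)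
    \<le> (\<integral>\<^sup>+\<omega>. ennreal (exp (A / R\<^sup>2 * (total_noise k (\<lambda>j. \<xi> j \<omega>)
      + (if near (iterate k (\<lambda>j. \<xi> j \<omega>))
         then noise1 (iterate k (\<lambda>j. \<xi> j \<omega>)) (\<lambda>i. \<xi> (Inl (k, i)) \<omega>) else 0)))) \<partial>M)
      * ennreal (exp (A / (2 * N)))"
proof -
  let ?c = "A / R\<^sup>2"
  let ?B = "(\<lambda>i. Inr (k, i)) ` {1..m2} :: ((nat \<times> nat) + (nat \<times> nat)) set"
  let ?S = "PiM (past (Suc k) k) (\<lambda>_. D)" and ?T = "PiM ?B (\<lambda>_. D)"
  let ?y = "\<lambda>p. extrapolate (iterate k p) (\<lambda>i. p (Inl (k, i)))"
  define X where "X \<omega> = restrict (\<lambda>j. \<xi> j \<omega>) (past (Suc k) k)" for \<omega>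
  define Y where "Y \<omega> = restrict (\<lambda>j. \<xi> j \<omega>) ?B" for \<omega>
  define h where "h p = ?c * (total_noise k p
      + (if near (iterate k p) then noise1 (iterate k p) (\<lambda>i. p (Inl (k, i))) else 0))" for p
  define f :: "((nat \<times> nat) + (nat \<times> nat) \<Rightarrow> 's) \<times> ((nat \<times> nat) + (nat \<times> nat) \<Rightarrow> 's) \<Rightarrow> ennreal"
    where "f = (\<lambda>(p, s). ennreal (exp (h p
      + (if near (iterate k p) then ?c * noise2 (iterate k p) (?y p) (\<lambda>i. s (Inr (k, i))) else 0))))"
  define g where "g p = ennreal (exp (h p)) * ennreal (exp (A / (2 * N)))" for p
  have ind: "indep_var ?S X ?T Y"
    unfolding X_def Y_def by (rule indep_var_restrict[OF indep]) (auto simp: past_def)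
  have fst': "(\<lambda>z. fst z j) \<in> measurable (?S \<Otimes>\<^sub>M ?T) D" if "j \<in> past (Suc k) k" for j
    using that by measurable
  have fst'': "(\<lambda>z. fst z j) \<in> measurable (?S \<Otimes>\<^sub>M ?T) D" if "j \<in> past k k" for j
    using that by (intro fst') (auto simp: past_def)
  have snd': "(\<lambda>z. snd z (Inr (k, i))) \<in> measurable (?S \<Otimes>\<^sub>M ?T) D" if "i \<in> {1..m2}" for i
    using that by (intro measurable_compose[OF measurable_snd measurable_component_singleton]) auto
  have it[measurable]: "(\<lambda>z. iterate k (fst z)) \<in> borel_measurable (?S \<Otimes>\<^sub>M ?T)"
    and [measurable]: "(\<lambda>z. total_noise k (fst z)) \<in> borel_measurable (?S \<Otimes>\<^sub>M ?T)"
    by (intro measurable_iterate measurable_total_noise fst''; assumption)+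
  have ex[measurable]: "(\<lambda>z. ?y (fst z)) \<in> borel_measurable (?S \<Otimes>\<^sub>M ?T)"
    by (intro measurable_extrapolate it fst') simp
  have [measurable]: "(\<lambda>z. noise1 (iterate k (fst z)) (\<lambda>i. fst z (Inl (k, i)))) \<in> borel_measurable (?S \<Otimes>\<^sub>M ?T)"
    by (intro measurable_noise1 it fst') simp
  have [measurable]: "(\<lambda>z. noise2 (iterate k (fst z)) (?y (fst z)) (\<lambda>i. snd z (Inr (k, i))))
      \<in> borel_measurable (?S \<Otimes>\<^sub>M ?T)"
    by (intro measurable_noise2 it ex snd')
  have f: "f \<in> borel_measurable (?S \<Otimes>\<^sub>M ?T)"
    unfolding f_def h_def case_prod_beta by measurable
  have Yn: "noise2 x y (\<lambda>i. Y \<omega> (Inr (k, i))) = noise2 x y (\<lambda>i. \<xi> (Inr (k, i)) \<omega>)" for x y \<omega>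
    by (rule noise2_cong) (simp add: Y_def)
  have le: "(\<integral>\<^sup>+\<omega>. f (p, Y \<omega>) \<partial>M) \<le> g p" for p
  proof (cases "near (iterate k p)")
    case True
    have [measurable]: "(\<lambda>\<omega>. noise2 (iterate k p) (?y p) (\<lambda>i. \<xi> (Inr (k, i)) \<omega>)) \<in> borel_measurable M"
      by (intro measurable_noise2 measurable_sample) auto
    have "f (p, Y \<omega>) = ennreal (exp (h p))
        * ennreal (exp (?c * noise2 (iterate k p) (?y p) (\<lambda>i. \<xi> (Inr (k, i)) \<omega>)))" for \<omega>
      using True by (simp add: f_def Yn exp_add ennreal_mult)
    then have "(\<integral>\<^sup>+\<omega>. f (p, Y \<omega>) \<partial>M) = ennreal (exp (h p))
        * (\<integral>\<^sup>+\<omega>. ennreal (exp (?c * noise2 (iterate k p) (?y p) (\<lambda>i. \<xi> (Inr (k, i)) \<omega>))) \<partial>M)"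
      by (simp add: nn_integral_cmult)
    then show ?thesis
      using exp_noise2_le[OF True extrapolate_in_cball[OF True]] by (simp add: g_def mult_left_mono)
  next
    case False
    have "exp (h p) * 1 \<le> exp (h p) * exp (A / (2 * N))"
      using A N by (intro mult_left_mono) auto
    then show ?thesis
      using False by (simp add: f_def g_def emeasure_space_1 flip: ennreal_mult)
  qed
  have tn: "total_noise k (X \<omega>) = total_noise k (\<lambda>j. \<xi> j \<omega>)"
    and itX: "iterate k (X \<omega>) = iterate k (\<lambda>j. \<xi> j \<omega>)" for \<omega>
    by (intro total_noise_cong iterate_cong; auto simp: X_def past_def)+
  have n1: "noise1 x (\<lambda>i. X \<omega> (Inl (k, i))) = noise1 x (\<lambda>i. \<xi> (Inl (k, i)) \<omega>)"
    and ex': "extrapolate x (\<lambda>i. X \<omega> (Inl (k, i))) = extrapolate x (\<lambda>i. \<xi> (Inl (k, i)) \<omega>)" for x \<omega>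
    by (intro noise1_cong extrapolate_cong; simp add: X_def)+
  have hX: "h (X \<omega>) = h (\<lambda>j. \<xi> j \<omega>)" for \<omega>
    by (simp add: h_def tn itX n1)
  have it': "(\<lambda>\<omega>. iterate k (\<lambda>j. \<xi> j \<omega>)) \<in> borel_measurable M"
    using past_subset by (intro measurable_iterate measurable_sample) auto
  have [measurable]: "(\<lambda>\<omega>. total_noise k (\<lambda>j. \<xi> j \<omega>)) \<in> borel_measurable M"
    using past_subset by (intro measurable_total_noise measurable_sample) auto
  have [measurable]: "(\<lambda>\<omega>. noise1 (iterate k (\<lambda>j. \<xi> j \<omega>)) (\<lambda>i. \<xi> (Inl (k, i)) \<omega>)) \<in> borel_measurable M"
    by (intro measurable_noise1 it' measurable_sample) auto
  note [measurable] = it'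
  have hm[measurable]: "(\<lambda>\<omega>. h (\<lambda>j. \<xi> j \<omega>)) \<in> borel_measurable M"
    unfolding h_def by measurable
  \<comment> \<open>The last summand of the noise is split: its \<open>noise1\<close> part is
    already in \<open>h\<close>, and \<open>noise2\<close> is added by \<open>f\<close>.\<close>
  have fXY: "f (X \<omega>, Y \<omega>) = ennreal (exp (?c * total_noise (Suc k) (\<lambda>j. \<xi> j \<omega>)))" for \<omega>
    by (simp add: f_def hX itX ex' Yn) (simp add: h_def total_noise_def distrib_left add_divide_distrib)
  have "(\<integral>\<^sup>+\<omega>. f (X \<omega>, Y \<omega>) \<partial>M) \<le> (\<integral>\<^sup>+\<omega>. g (X \<omega>) \<partial>M)"
    by (rule nn_integral_indep_le[OF ind f le])
  also have "\<dots> = (\<integral>\<^sup>+\<omega>. ennreal (exp (h (\<lambda>j. \<xi> j \<omega>))) \<partial>M) * ennreal (exp (A / (2 * N)))"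
    by (simp add: g_def hX nn_integral_multc)
  finally show ?thesis
    by (simp add: fXY h_def)
qed

lemma exp_total_noise_le:
  "(\<integral>\<^sup>+\<omega>. ennreal (exp (A / R\<^sup>2 * total_noise k (\<lambda>j. \<xi> j \<omega>))) \<partial>M) \<le> ennreal (exp (A / N * real k))"
proof (induction k)
  case 0
  show ?case
    by (simp add: total_noise_def emeasure_space_1)
next
  case (Suc k)
  let ?d = "ennreal (exp (A / (2 * N)))"
  have "(\<integral>\<^sup>+\<omega>. ennreal (exp (A / R\<^sup>2 * total_noise (Suc k) (\<lambda>j. \<xi> j \<omega>))) \<partial>M)
      \<le> (\<integral>\<^sup>+\<omega>. ennreal (exp (A / R\<^sup>2 * total_noise k (\<lambda>j. \<xi> j \<omega>))) \<partial>M) * ?d * ?d"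
    by (rule order_trans[OF exp_total_noise_half_step2 mult_right_mono[OF exp_total_noise_half_step1]]) simp
  also have "\<dots> \<le> ennreal (exp (A / N * real k)) * ?d * ?d"
    by (intro mult_right_mono Suc.IH) simp_all
  also have "\<dots> = ennreal (exp (A / N * real (Suc k)))"
    using N by (simp add: ennreal_mult[symmetric] exp_add[symmetric] field_simps)
  finally show ?case .
qed

section \<open>Tail bounds and the high-probability estimate\<close>

text \<open>Markov's inequality at rate \<open>A / R\<^sup>2\<close>: the threshold costs
  \<open>exp (- 3 * A)\<close>, and the moment is at most \<open>exp A\<close> because
  \<open>real k \<le> N\<close>.\<close>

lemma total_noise_tail:
  assumes "real k \<le> N"
  shows "prob {\<omega> \<in> space M. 3 * R\<^sup>2 < total_noise k (\<lambda>j. \<xi> j \<omega>)} \<le> exp (- 2 * A)"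
proof -
  let ?U = "\<lambda>\<omega>. total_noise k (\<lambda>j. \<xi> j \<omega>)"
  have [measurable]: "?U \<in> borel_measurable M"
    using past_subset by (intro measurable_total_noise measurable_sample) auto
  have "ennreal (prob {\<omega> \<in> space M. 3 * R\<^sup>2 < ?U \<omega>})
      = (\<integral>\<^sup>+\<omega>. indicator {\<omega> \<in> space M. 3 * R\<^sup>2 < ?U \<omega>} \<omega> \<partial>M)"
    by (simp add: emeasure_eq_measure)
  also have "\<dots> \<le> (\<integral>\<^sup>+\<omega>. ennreal (exp (- 3 * A)) * ennreal (exp (A / R\<^sup>2 * ?U \<omega>)) \<partial>M)"
  proof (rule nn_integral_mono)
    fix \<omega>
    have "1 \<le> exp (- 3 * A) * exp (A / R\<^sup>2 * ?U \<omega>)" if "3 * R\<^sup>2 < ?U \<omega>"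
    proof -
      have "A / R\<^sup>2 * (3 * R\<^sup>2) \<le> A / R\<^sup>2 * ?U \<omega>"
        using that A by (intro mult_left_mono) auto
      then have "3 * A \<le> A / R\<^sup>2 * ?U \<omega>"
        using R by simp
      then show ?thesis
        by (simp add: exp_add[symmetric])
    qed
    then show "indicator {\<omega> \<in> space M. 3 * R\<^sup>2 < ?U \<omega>} \<omega>
        \<le> ennreal (exp (- 3 * A)) * ennreal (exp (A / R\<^sup>2 * ?U \<omega>))"
      by (auto simp: indicator_def ennreal_mult[symmetric] ennreal_ge_1)
  qed
  also have "\<dots> = ennreal (exp (- 3 * A)) * (\<integral>\<^sup>+\<omega>. ennreal (exp (A / R\<^sup>2 * ?U \<omega>)) \<partial>M)"
    by (rule nn_integral_cmult) measurable
  also have "\<dots> \<le> ennreal (exp (- 3 * A)) * ennreal (exp (A / N * real k))"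
    by (intro mult_left_mono exp_total_noise_le) simp
  also have "\<dots> = ennreal (exp (- 3 * A + A / N * real k))"
    by (simp add: mult_exp_exp flip: ennreal_mult)
  finally have "prob {\<omega> \<in> space M. 3 * R\<^sup>2 < ?U \<omega>} \<le> exp (- 3 * A + A / N * real k)"
    by simp
  moreover have "A / N * real k \<le> A"
    using assms A N by (simp add: field_simps)
  ultimately show ?thesis
    using exp_le_cancel_iff[of "- 3 * A + A / N * real k" "- 2 * A"] by linarith
qed

text \<open>The bound at \<open>k\<close> itself shows that iterate \<open>k\<close> is near, so the
  noise of that iteration is counted and the induction can continue.\<close>

lemma descent:
  assumes "\<And>j. j \<le> n \<Longrightarrow> total_noise j p \<le> 3 * R\<^sup>2" and "k \<le> n"
  shows "(norm (iterate k p - xs))\<^sup>2 + \<gamma>1 * \<gamma>2 / 4 * (\<Sum>j<k. (norm (F (iterate j p)))\<^sup>2)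
    \<le> R\<^sup>2 + total_noise k p"
  using \<open>k \<le> n\<close>
proof (induction k)
  case 0
  then show ?case
    using start by (simp add: iterate_0 total_noise_def power_mono)
next
  case (Suc k)
  let ?x = "iterate k p"
  have IH: "(norm (?x - xs))\<^sup>2 + \<gamma>1 * \<gamma>2 / 4 * (\<Sum>j<k. (norm (F (iterate j p)))\<^sup>2) \<le> R\<^sup>2 + total_noise k p"
    using Suc by simp
  have "0 \<le> \<gamma>1 * \<gamma>2 / 4 * (\<Sum>j<k. (norm (F (iterate j p)))\<^sup>2)"
    using \<gamma>2 \<gamma>_pos by (intro mult_nonneg_nonneg sum_nonneg) auto
  then have "(norm (?x - xs))\<^sup>2 \<le> R\<^sup>2 + total_noise k p"
    using IH by linarith
  \<comment> \<open>The noise threshold \<open>3 * R\<^sup>2\<close> is exactly what keeps the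
    squared distance below \<open>(2 * R)\<^sup>2\<close>.\<close>
  also have "\<dots> \<le> (2 * R)\<^sup>2"
    using assms(1)[of k] Suc.prems by simp
  finally have near: "near ?x"
    unfolding near_def by (rule power2_le_imp_le) (use R in simp)
  let ?y = "extrapolate ?x (\<lambda>i. p (Inl (k, i)))"
  have "(norm (iterate (Suc k) p - xs))\<^sup>2 + \<gamma>1 * \<gamma>2 / 4 * (norm (F ?x))\<^sup>2
      \<le> (norm (?x - xs))\<^sup>2 + (noise1 ?x (\<lambda>i. p (Inl (k, i))) + noise2 ?x ?y (\<lambda>i. p (Inr (k, i))))"
    using noise_step[OF near] by (simp add: iterate_Suc add.assoc)
  moreover have "total_noise (Suc k) p = total_noise k p
      + (noise1 ?x (\<lambda>i. p (Inl (k, i))) + noise2 ?x ?y (\<lambda>i. p (Inr (k, i))))"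
    using near by (simp add: total_noise_def)
  moreover have "\<gamma>1 * \<gamma>2 / 4 * (\<Sum>j<Suc k. (norm (F (iterate j p)))\<^sup>2)
      = \<gamma>1 * \<gamma>2 / 4 * (\<Sum>j<k. (norm (F (iterate j p)))\<^sup>2) + \<gamma>1 * \<gamma>2 / 4 * (norm (F ?x))\<^sup>2"
    by (simp add: distrib_left)
  ultimately show ?case
    using IH by linarith
qed

lemma sum_norm_F_high_probability:
  assumes "real n \<le> N"
  shows "1 - (real n + 1) * exp (- 2 * A)
    \<le> prob {\<omega> \<in> space M. (\<Sum>j<n. (norm (F (iterate j (\<lambda>j. \<xi> j \<omega>))))\<^sup>2) \<le> 16 * R\<^sup>2 / (\<gamma>1 * \<gamma>2)}"
    (is "_ \<le> prob ?good")
proof -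
  let ?bad = "\<lambda>k. {\<omega> \<in> space M. 3 * R\<^sup>2 < total_noise k (\<lambda>j. \<xi> j \<omega>)}"
  have [measurable]: "(\<lambda>\<omega>. iterate k (\<lambda>j. \<xi> j \<omega>)) \<in> borel_measurable M"
    "(\<lambda>\<omega>. total_noise k (\<lambda>j. \<xi> j \<omega>)) \<in> borel_measurable M" for k
    using past_subset by (intro measurable_iterate measurable_total_noise measurable_sample; auto)+
  have bad: "?bad k \<in> events" for k
    by measurable
  have good: "?good \<in> events"
    by measurable
  \<comment> \<open>A union bound over the \<open>n + 1\<close> partial sums with \<open>k\<close>
    from 0 to \<open>n\<close>.\<close>
  have "prob (\<Union>k\<le>n. ?bad k) \<le> (\<Sum>k\<le>n. prob (?bad k))"
    using bad by (intro finite_measure_subadditive_finite) auto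
  also have "\<dots> \<le> (\<Sum>k\<le>n. exp (- 2 * A))"
    using assms by (intro sum_mono total_noise_tail) simp
  also have "\<dots> = (real n + 1) * exp (- 2 * A)"
    by simp
  finally have "1 - (real n + 1) * exp (- 2 * A) \<le> 1 - prob (\<Union>k\<le>n. ?bad k)"
    by simp
  also have "\<dots> = prob (space M - (\<Union>k\<le>n. ?bad k))"
    using bad by (subst prob_compl) auto
  also have "\<dots> \<le> prob ?good"
  proof (rule finite_measure_mono[OF _ good], rule subsetI)
    fix \<omega>
    assume \<omega>: "\<omega> \<in> space M - (\<Union>k\<le>n. ?bad k)"
    let ?p = "\<lambda>j. \<xi> j \<omega>"
    have small: "total_noise k ?p \<le> 3 * R\<^sup>2" if "k \<le> n" for k
      using \<omega> that by (auto simp: not_less)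
    have "\<gamma>1 * \<gamma>2 / 4 * (\<Sum>j<n. (norm (F (iterate j ?p)))\<^sup>2)
        \<le> (norm (iterate n ?p - xs))\<^sup>2 + \<gamma>1 * \<gamma>2 / 4 * (\<Sum>j<n. (norm (F (iterate j ?p)))\<^sup>2)"
      by simp
    also have "\<dots> \<le> R\<^sup>2 + total_noise n ?p"
      by (rule descent[where n = n]) (use small in auto)
    \<comment> \<open>Division of \<open>4 * R\<^sup>2\<close> by
      \<open>\<gamma>1 * \<gamma>2 / 4\<close> gives the constant 16.\<close>
    also have "\<dots> \<le> 4 * R\<^sup>2"
      using small[of n] by simp
    finally show "\<omega> \<in> ?good"
      using \<omega> \<gamma>2 \<gamma>_pos by (simp add: field_simps)
  qed
  finally show ?thesis .
qed

end

section \<open>Instantiation of the process and the final probability bound\<close>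

theorem theoremC2:
  fixes M :: "'w measure" and D :: "'s measure"
    and G :: "'a::euclidean_space \<Rightarrow> 's \<Rightarrow> 'a" and F :: "'a \<Rightarrow> 'a"
    and \<xi>1 \<xi>2 :: "nat \<Rightarrow> nat \<Rightarrow> 'w \<Rightarrow> 's"
    and x0 xs :: 'a and Q :: "'a set"
    and R L \<rho> \<sigma> \<beta> \<gamma>1 \<gamma>2 lam1 lam2 :: real and m1 m2 K :: nat
  assumes "prob_space M"
    and "stochastic_oracle D G F"
    and "independent_samples M D (\<lambda>_. m1) (\<lambda>_. m2) \<xi>1 \<xi>2"
    and "xs \<in> solutions F" and "\<forall>y\<in>solutions F. norm (x0 - xs) \<le> norm (x0 - y)"
    and "R > 0" and "R \<ge> norm (x0 - xs)" and "Q = cball xs (3 * R)"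
    and "bounded_variance_on Q D G F \<sigma>"
    and "L > 0" and "L-lipschitz_on Q F"
    and "\<rho> \<ge> 0" and "star_negative_comonotone_on Q F \<rho>"
    and "0 < \<beta>" and "\<beta> \<le> 1" and "ln (6 * (real K + 1) / \<beta>) \<ge> 1"
    and "\<gamma>1 > 0" and "\<gamma>2 > 0"
    and "\<gamma>2 + 2 * \<rho> \<le> \<gamma>1" and "\<gamma>1 \<le> 1 / (160 * L * ln (6 * (real K + 1) / \<beta>))"
    and "lam1 = R / (20 * \<gamma>1 * ln (6 * (real K + 1) / \<beta>))"
    and "lam2 = R / (20 * \<gamma>2 * ln (6 * (real K + 1) / \<beta>))"
    and "real m1 \<ge> max 1 (216 * max (\<gamma>1 * \<gamma>2 * (real K + 1))
           (sqrt (\<gamma>1 ^ 3 * \<gamma>2 * (real K + 1)) * ln (6 * (real K + 1) / \<beta>)) * \<sigma>\<^sup>2 / R\<^sup>2)"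
    and "real m2 \<ge> max 1 (3240 * (real K + 1) * \<gamma>2\<^sup>2 * \<sigma>\<^sup>2 * ln (6 * (real K + 1) / \<beta>) / R\<^sup>2)"
  shows "measure M {\<omega> \<in> space M.
           1 / (real K + 1) * (\<Sum>k=0..K. (norm (F (clipped_SEG G \<gamma>1 \<gamma>2 (\<lambda>_. lam1) (\<lambda>_. lam2)
               (\<lambda>_. m1) (\<lambda>_. m2) x0 (\<lambda>k i. \<xi>1 k i \<omega>) (\<lambda>k i. \<xi>2 k i \<omega>) k)))\<^sup>2)
           \<le> 36 * R\<^sup>2 / (\<gamma>1 * \<gamma>2 * (real K + 1))} \<ge> 1 - \<beta>"
proof -
  interpret prob_space M
    by fact
  define A where "A = ln (6 * (real K + 1) / \<beta>)"
  define N where "N = real K + 1"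
  define \<xi> where "\<xi> = case_sum (\<lambda>(k, i). \<xi>1 k i) (\<lambda>(k, i). \<xi>2 k i)"
  have A: "1 \<le> A" and N: "0 < N"
    using assms by (auto simp: A_def N_def)
  have m: "0 < m1" "0 < m2"
    using assms(23,24) by auto
  have var1: "\<gamma>1 * \<gamma>2 * (\<sigma>\<^sup>2 / real m1) \<le> R\<^sup>2 / (216 * N)"
  proof -
    have "216 * (\<gamma>1 * \<gamma>2 * N) * \<sigma>\<^sup>2 / R\<^sup>2 \<le> 216 * max (\<gamma>1 * \<gamma>2 * (real K + 1))
           (sqrt (\<gamma>1 ^ 3 * \<gamma>2 * (real K + 1)) * ln (6 * (real K + 1) / \<beta>)) * \<sigma>\<^sup>2 / R\<^sup>2"
      unfolding N_def by (intro divide_right_mono mult_right_mono mult_left_mono) auto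
    also have "\<dots> \<le> real m1"
      using assms(23) by simp
    finally show ?thesis
      using \<open>R > 0\<close> m N by (simp add: field_simps)
  qed
  have var2: "\<gamma>2\<^sup>2 * (\<sigma>\<^sup>2 / real m2) \<le> R\<^sup>2 / (3240 * N * A)"
  proof -
    have "3240 * N * \<gamma>2\<^sup>2 * \<sigma>\<^sup>2 * A / R\<^sup>2 \<le> real m2"
      using assms(24) by (simp add: A_def N_def)
    then show ?thesis
      using \<open>R > 0\<close> m N A by (simp add: field_simps)
  qed
  note hyps = assms[unfolded \<open>Q = cball xs (3 * R)\<close>, folded A_def]
  interpret clipped_SEG_process M D G F \<xi> x0 xs R L \<rho> \<sigma> A N \<gamma>1 \<gamma>2 lam1 lam2 m1 m2
  proof
    show "indep_vars (\<lambda>_. D) \<xi> (UNIV \<times> {1..m1} <+> UNIV \<times> {1..m2})"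
      using assms(3) by (simp add: independent_samples_def \<xi>_def)
    show "distr M D (\<xi> j) = D" if "j \<in> UNIV \<times> {1..m1} <+> UNIV \<times> {1..m2}" for j
      using assms(3) that by (auto simp: independent_samples_def \<xi>_def)
  qed (rule hyps A N m var1 var2)+
  have it: "iterate k (\<lambda>j. \<xi> j \<omega>) = clipped_SEG G \<gamma>1 \<gamma>2 (\<lambda>_. lam1) (\<lambda>_. lam2)
      (\<lambda>_. m1) (\<lambda>_. m2) x0 (\<lambda>k i. \<xi>1 k i \<omega>) (\<lambda>k i. \<xi>2 k i \<omega>) k" for k \<omega>
    by (simp add: iterate_def \<xi>_def)
  have [measurable]: "(\<lambda>\<omega>. iterate k (\<lambda>j. \<xi> j \<omega>)) \<in> borel_measurable M" for k
    using past_subset by (intro measurable_iterate measurable_sample) auto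
  \<comment> \<open>The \<open>K + 1\<close> iterates need \<open>n = Suc K\<close>, hence
    \<open>K + 2\<close> events. Since \<open>K + 2 \<le> 6 * N\<close> and
    \<open>exp (- A) = \<beta> / (6 * N)\<close>, one factor \<open>exp (- A)\<close> already
    absorbs their number.\<close>
  have "(real (Suc K) + 1) * exp (- 2 * A) \<le> \<beta>"
  proof -
    have exp_A: "exp (- A) = \<beta> / (6 * N)"
      using \<open>0 < \<beta>\<close> by (simp add: A_def N_def exp_minus)
    have "exp (- 2 * A) \<le> exp (- A)"
      using A by simp
    then have "(real (Suc K) + 1) * exp (- 2 * A) \<le> (6 * N) * exp (- A)"
      by (intro mult_mono) (auto simp: N_def)
    then show ?thesis
      using N by (simp add: exp_A)
  qed
  then have "1 - \<beta> \<le> 1 - (real (Suc K) + 1) * exp (- 2 * A)"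
    by simp
  also have "\<dots> \<le> prob {\<omega> \<in> space M. (\<Sum>j<Suc K. (norm (F (iterate j (\<lambda>j. \<xi> j \<omega>))))\<^sup>2) \<le> 16 * R\<^sup>2 / (\<gamma>1 * \<gamma>2)}"
    by (rule sum_norm_F_high_probability) (simp add: N_def)
  also have "\<dots> \<le> prob {\<omega> \<in> space M. 1 / (real K + 1) * (\<Sum>k=0..K. (norm (F (iterate k (\<lambda>j. \<xi> j \<omega>))))\<^sup>2)
      \<le> 36 * R\<^sup>2 / (\<gamma>1 * \<gamma>2 * (real K + 1))}"
  proof (rule finite_measure_mono, rule subsetI)
    fix \<omega>
    assume \<omega>: "\<omega> \<in> {\<omega> \<in> space M. (\<Sum>j<Suc K. (norm (F (iterate j (\<lambda>j. \<xi> j \<omega>))))\<^sup>2) \<le> 16 * R\<^sup>2 / (\<gamma>1 * \<gamma>2)}"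
    have "16 * R\<^sup>2 / (\<gamma>1 * \<gamma>2) \<le> 36 * R\<^sup>2 / (\<gamma>1 * \<gamma>2)"
      using \<open>\<gamma>1 > 0\<close> \<open>\<gamma>2 > 0\<close> by (intro divide_right_mono) auto
    then have "(\<Sum>k=0..K. (norm (F (iterate k (\<lambda>j. \<xi> j \<omega>))))\<^sup>2) \<le> 36 * R\<^sup>2 / (\<gamma>1 * \<gamma>2)"
      using \<omega> by (simp add: lessThan_Suc_atMost atLeast0AtMost)
    then have "(\<Sum>k=0..K. (norm (F (iterate k (\<lambda>j. \<xi> j \<omega>))))\<^sup>2) / (real K + 1)
        \<le> 36 * R\<^sup>2 / (\<gamma>1 * \<gamma>2) / (real K + 1)"
      by (rule divide_right_mono) simp
    then show "\<omega> \<in> {\<omega> \<in> space M. 1 / (real K + 1) * (\<Sum>k=0..K. (norm (F (iterate k (\<lambda>j. \<xi> j \<omega>))))\<^sup>2)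
      \<le> 36 * R\<^sup>2 / (\<gamma>1 * \<gamma>2 * (real K + 1))}"
      using \<omega> by simp
  qed measurable
  finally show ?thesis
    unfolding it .
qed

end
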